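(* Let $\mathrm{K}_V^{\mathbf t}$ be a complete $\mathbf t$-spread $d$-partite hypergraph. Then the edge ideal $I(\mathrm{K}_V^{\mathbf t})$ satisfies the strong persistence property, and all powers of $I(\mathrm{K}_V^{\mathbf t})$ have linear resolution.
   Context: Setting. Let $n,d\ge 1$ be integers, $[n]=\{1,\dots,n\}$, and let $\mathbf t=(t_1,\dots,t_{d-1})$ be a vector of integers with $t_i\ge 1$ for all $i$. Let $V=\{V_1,\dots,V_d\}$ be a family of nonempty, pairwise disjoint subsets of $[n]$ such that $p<q$ whenever $p\in V_i$, $q\in V_j$ and $i<j$. A $\mathbf t$-spread edge is a set $\{k_1,\dots,k_d\}$ with $k_j\in V_j$ for $j=1,\dots,d$ and $k_j-k_{j-1}\ge t_{j-1}$ for $j=2,\dots,d$. The complete $\mathbf t$-spread $d$-partite hypergraph $\mathrm{K}_V^{\mathbf t}$ is the hypergraph with vertex set $V(\mathrm{K}_V^{\mathbf t})=V_1\cup\dots\cup V_d$ whose edges are all the $\mathbf t$-spread edges. Standing assumption: $\mathrm{K}_V^{\mathbf t}$ has no isolated vertices, i.e. every vertex belongs to at least one edge. Let $\mathbb{K}$ be a field and $S=\mathbb{K}[x_1,\dots,x_n]$. The edge ideal $I(\mathrm{K}_V^{\mathbf t})\subset S$ is the ideal generated by the monomials $x_{k_1}\cdots x_{k_d}$, where $\{k_1,\dots,k_d\}$ runs over the edges of $\mathrm{K}_V^{\mathbf t}$. An ideal $I$ satisfies the strong persistence property if $(I^{k+1}:I)=I^k$ for all $k\ge 1$. A homogeneous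 ideal $J\subset S$ with graded Betti numbers $\beta_{i,j}(J)$ has an $m$-linear resolution if $\beta_{i,j}(J)=0$ for all $i$ and all $j\ne i+m$; it has linear resolution if it has an $m$-linear resolution for some $m$. *)

theory Defs
  imports "HOL-Library.Poly_Mapping" "HOL-Library.Disjoint_Sets" "HOL-Algebra.Ideal_Product"
begin

section \<open>The polynomial ring in n variables\<close>

text \<open>
  Exponent vectors are finitely supported functions \<^typ>\<open>nat \<Rightarrow>\<^sub>0 nat\<close>, so the type
  below is a polynomial ring in countably many variables; the ring in the variables
  with indices \<open>1, \<dots>, n\<close> is the subring \<open>poly_ring n\<close>.
\<close>

type_synonym 'k mpoly = "(nat \<Rightarrow>\<^sub>0 nat) \<Rightarrow>\<^sub>0 'k"

definition poly_ring :: "nat \<Rightarrow> 'k::field mpoly ring" where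
  "poly_ring n =
     \<lparr> carrier = {p. \<forall>m \<in> Poly_Mapping.keys p. Poly_Mapping.keys m \<subseteq> {1..n}},
       mult = (*), one = 1, zero = 0, add = (+) \<rparr>"

definition var :: "nat \<Rightarrow> 'k::field mpoly" where
  "var i = Poly_Mapping.single (Poly_Mapping.single i 1) 1"

definition monom_degree :: "(nat \<Rightarrow>\<^sub>0 nat) \<Rightarrow> nat" where
  "monom_degree m = (\<Sum>i \<in> Poly_Mapping.keys m. Poly_Mapping.lookup m i)"

text \<open>The polynomial 0 is homogeneous of every degree.\<close>

definition homogeneous :: "nat \<Rightarrow> 'k::field mpoly \<Rightarrow> bool" where
  "homogeneous e p \<longleftrightarrow> (\<forall>m \<in> Poly_Mapping.keys p. monom_degree m = e)"


section \<open>Ideals\<close>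

definition homogeneous_ideal :: "nat \<Rightarrow> 'k::field mpoly set \<Rightarrow> bool" where
  "homogeneous_ideal n J \<longleftrightarrow>
     (\<exists>G \<subseteq> carrier (poly_ring n). (\<forall>g \<in> G. \<exists>e. homogeneous e g) \<and> J = Idl\<^bsub>poly_ring n\<^esub> G)"

definition ideal_power :: "nat \<Rightarrow> 'k::field mpoly set \<Rightarrow> nat \<Rightarrow> 'k mpoly set" where
  "ideal_power n I k = I [^]\<^bsub>ideals_set (poly_ring n)\<^esub> k"

definition ideal_colon :: "nat \<Rightarrow> 'k::field mpoly set \<Rightarrow> 'k mpoly set \<Rightarrow> 'k mpoly set" where
  "ideal_colon n J I = {f \<in> carrier (poly_ring n). \<forall>g \<in> I. f * g \<in> J}"

definition strong_persistence :: "nat \<Rightarrow> 'k::field mpoly set \<Rightarrow> bool" where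
  "strong_persistence n I \<longleftrightarrow>
     (\<forall>k \<ge> 1. ideal_colon n (ideal_power n I (k + 1)) I = ideal_power n I k)"


section \<open>Minimal graded free resolutions and graded Betti numbers\<close>

text \<open>
  With S the ring \<open>poly_ring n\<close>, data for a complex
  \<open>\<cdots> \<rightarrow> F\<^sub>2 \<rightarrow> F\<^sub>1 \<rightarrow> F\<^sub>0 \<rightarrow> J\<close> of graded free S-modules of finite rank:
  \<open>F\<^sub>i\<close> has a basis indexed by \<open>s < rk i\<close> whose s-th element has degree \<open>shift i s\<close>,
  i.e. \<open>F\<^sub>i\<close> is the direct sum of the modules \<open>S(- shift i s)\<close>.  The augmentation sends the
  s-th basis element of \<open>F\<^sub>0\<close> to \<open>aug s\<close>, and \<open>mat i s t\<close> is the t-th coordinate of the image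
  in \<open>F\<^sub>i\<close> of the s-th basis element of \<open>F\<^sub>i\<^sub>+\<^sub>1\<close>.  Since J is an ideal of S, no basis element of
  a minimal resolution of J has negative degree, so natural numbers suffice as degrees.
\<close>

record (overloaded) 'k free_complex =
  rk :: "nat \<Rightarrow> nat"
  shift :: "nat \<Rightarrow> nat \<Rightarrow> nat"
  aug :: "nat \<Rightarrow> 'k mpoly"
  mat :: "nat \<Rightarrow> nat \<Rightarrow> nat \<Rightarrow> 'k mpoly"

text \<open>Elements of \<open>F\<^sub>i\<close> are coordinate vectors, extended by 0.\<close>

definition chains :: "nat \<Rightarrow> 'k::field free_complex \<Rightarrow> nat \<Rightarrow> (nat \<Rightarrow> 'k mpoly) set" where
  "chains n F i =
     {v. (\<forall>s < rk F i. v s \<in> carrier (poly_ring n)) \<and> (\<forall>s \<ge> rk F i. v s = 0)}"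

definition aug_map :: "'k::field free_complex \<Rightarrow> (nat \<Rightarrow> 'k mpoly) \<Rightarrow> 'k mpoly" where
  "aug_map F v = (\<Sum>s < rk F 0. v s * aug F s)"

definition boundary ::
    "'k::field free_complex \<Rightarrow> nat \<Rightarrow> (nat \<Rightarrow> 'k mpoly) \<Rightarrow> (nat \<Rightarrow> 'k mpoly)" where
  "boundary F i v =
     (\<lambda>t. if t < rk F i then \<Sum>s < rk F (i + 1). v s * mat F i s t else 0)"

definition graded_free_resolution ::
    "nat \<Rightarrow> 'k::field mpoly set \<Rightarrow> 'k free_complex \<Rightarrow> bool" where
  "graded_free_resolution n J F \<longleftrightarrow>
     (\<forall>s < rk F 0. aug F s \<in> carrier (poly_ring n) \<and> homogeneous (shift F 0 s) (aug F s)) \<and>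
     (\<forall>i. \<forall>s < rk F (i + 1). \<forall>t < rk F i. mat F i s t \<in> carrier (poly_ring n) \<and>
        (\<forall>m \<in> Poly_Mapping.keys (mat F i s t).
           monom_degree m + shift F i t = shift F (i + 1) s)) \<and>
     aug_map F ` chains n F 0 = J \<and>
     {v \<in> chains n F 0. aug_map F v = 0} = boundary F 0 ` chains n F 1 \<and>
     (\<forall>i. {v \<in> chains n F (i + 1). boundary F i v = (\<lambda>_. 0)}
          = boundary F (i + 1) ` chains n F (i + 2))"

text \<open>
  Minimality: the image of \<open>F\<^sub>i\<^sub>+\<^sub>1\<close> lies in \<open>\<mm> F\<^sub>i\<close>, where \<open>\<mm>\<close> is the graded maximal ideal,
  i.e. the matrix entries have no constant term.
\<close>

definition minimal_graded_free_resolution ::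
    "nat \<Rightarrow> 'k::field mpoly set \<Rightarrow> 'k free_complex \<Rightarrow> bool" where
  "minimal_graded_free_resolution n J F \<longleftrightarrow>
     graded_free_resolution n J F \<and>
     (\<forall>i. \<forall>s < rk F (i + 1). \<forall>t < rk F i. Poly_Mapping.lookup (mat F i s t) 0 = 0)"

text \<open>
  A homogeneous ideal has a minimal graded free resolution, unique up to isomorphism, so the
  choice does not matter.
\<close>

definition graded_betti :: "nat \<Rightarrow> 'k::field mpoly set \<Rightarrow> nat \<Rightarrow> nat \<Rightarrow> nat" where
  "graded_betti n J i j =
     (let F = (SOME F. minimal_graded_free_resolution n J F)
      in card {s. s < rk F i \<and> shift F i s = j})"

definition linear_resolution_of_degree :: "nat \<Rightarrow> nat \<Rightarrow> 'k::field mpoly set \<Rightarrow> bool" where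
  "linear_resolution_of_degree n m J \<longleftrightarrow>
     homogeneous_ideal n J \<and> (\<forall>i j. j \<noteq> i + m \<longrightarrow> graded_betti n J i j = 0)"

definition has_linear_resolution :: "nat \<Rightarrow> 'k::field mpoly set \<Rightarrow> bool" where
  "has_linear_resolution n J \<longleftrightarrow> (\<exists>m. linear_resolution_of_degree n m J)"


section \<open>Hypergraphs and edge ideals\<close>

record 'a hypergraph =
  vertices :: "'a set"
  edges :: "'a set set"

definition no_isolated_vertices :: "'a hypergraph \<Rightarrow> bool" where
  "no_isolated_vertices H \<longleftrightarrow> (\<forall>v \<in> vertices H. \<exists>e \<in> edges H. v \<in> e)"

definition edge_ideal :: "nat \<Rightarrow> nat hypergraph \<Rightarrow> 'k::field mpoly set" where
  "edge_ideal n H = Idl\<^bsub>poly_ring n\<^esub> {(\<Prod>i \<in> e. var i) | e. e \<in> edges H}"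

text \<open>
  The families \<open>V\<^sub>1, \<dots>, V\<^sub>d\<close> and \<open>t\<^sub>1, \<dots>, t\<^sub>d\<^sub>-\<^sub>1\<close> are functions of which only the values at these
  indices matter.  The condition on differences is written additively, as subtraction of
  natural numbers is truncated.
\<close>

definition spread_edges :: "nat \<Rightarrow> (nat \<Rightarrow> nat) \<Rightarrow> (nat \<Rightarrow> nat set) \<Rightarrow> nat set set" where
  "spread_edges d t V =
     {k ` {1..d} | k. (\<forall>j \<in> {1..d}. k j \<in> V j) \<and> (\<forall>j \<in> {2..d}. k (j - 1) + t (j - 1) \<le> k j)}"

definition complete_spread_hypergraph ::
    "nat \<Rightarrow> (nat \<Rightarrow> nat) \<Rightarrow> (nat \<Rightarrow> nat set) \<Rightarrow> nat hypergraph" where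
  "complete_spread_hypergraph d t V =
     \<lparr> vertices = (\<Union>j \<in> {1..d}. V j), edges = spread_edges d t V \<rparr>"

end

theory Submission
  imports Defs
begin

text \<open>
  Write the exponent vectors of the generators of \<open>I\<^sup>k\<close> by counting: for a monomial \<open>u\<close> let
  \<open>count_below u j x\<close> be the degree of \<open>u\<close> in the variables of \<open>V\<^sub>j\<close> with index below \<open>x\<close>.  A monomial
  is a product of \<open>k\<close> edges exactly if it is supported on the \<open>V\<^sub>j\<close>, has degree \<open>k\<close> in each of them, and
  at most as much of it lies below \<open>x + t\<^sub>j\<^sub>-\<^sub>1\<close> in \<open>V\<^sub>j\<close> as lies below \<open>x\<close> in \<open>V\<^sub>j\<^sub>-\<^sub>1\<close>, for all \<open>j\<close> and \<open>x\<close>: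
  the smallest vertices of its support in the \<open>V\<^sub>j\<close> then form an edge, and removing this edge
  preserves the condition (\<open>sums_of_edge_monomials\<close>).  Both claims of the theorem follow from this
  description.

  \<^emph>\<open>Linear resolutions.\<close>  Order the generators of \<open>I\<^sup>k\<close> lexicographically, the larger ones
  first.  If \<open>u < v\<close> and \<open>p\<close> is the first index where they differ, then \<open>p\<close> lies in some \<open>V\<^sub>j\<close>, and
  trading the next variable of \<open>u\<close> in \<open>V\<^sub>j\<close> for \<open>x\<^sub>p\<close> gives a generator \<open>w > u\<close>: the counts of \<open>w\<close> are
  bounded by those of \<open>u\<close> and \<open>v\<close> (\<open>spread_monomials_exchange\<close>).  So every colon ideal of an initial
  segment by the next generator is generated by variables, i.e. \<open>I\<^sup>k\<close> has linear quotients.  That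
  linear quotients give a linear resolution is shown for submodules of free modules, because this
  class is closed under passing to syzygies: if \<open>x\<^sub>p g\<^sub>r\<close> is a combination of the earlier
  generators, the syzygy with leading term \<open>x\<^sub>p e\<^sub>r\<close> can be chosen linear, and these syzygies, added
  one at a time, again have linear quotients, in the next degree (\<open>syzygies_linear\<close>).  Iterating
  constructs a minimal resolution.  An arbitrary minimal resolution uses other generators, but
  these are related to the given ones by an invertible matrix over the field, so the argument
  applies to it as well (\<open>minimal_generators_linear\<close>).

  \<^emph>\<open>Strong persistence.\<close>  Let \<open>w\<close> be a monomial with \<open>w e \<in> I\<^sup>k\<^sup>+\<^sup>1\<close> for all edges \<open>e\<close>.  If \<open>D\<close> is a
  minimal vertex cover, some edge \<open>e\<close> meets \<open>D\<close> only once; as each of the \<open>k + 1\<close> edges dividing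
  \<open>w e\<close> meets \<open>D\<close>, the degree of \<open>w\<close> in \<open>D\<close> is at least \<open>k\<close>.  By a max-flow min-cut theorem for
  chains, a monomial with this property for all covers is divisible by \<open>k\<close> edges
  (\<open>max_flow_min_cut\<close>).
\<close>

section \<open>Polynomials and exponent vectors\<close>

abbreviation polys :: "nat \<Rightarrow> 'k::field mpoly set" where
  "polys n \<equiv> carrier (poly_ring n)"

lemma polys_iff: "p \<in> polys n \<longleftrightarrow> (\<forall>m \<in> Poly_Mapping.keys p. Poly_Mapping.keys m \<subseteq> {1..n})"
  by (simp add: poly_ring_def)

lemma keys_minus_general: "Poly_Mapping.keys (- p) = Poly_Mapping.keys (p :: 'a \<Rightarrow>\<^sub>0 'b::ab_group_add)"
  by (auto simp: in_keys_iff)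

lemma keys_diff_general: 
  "Poly_Mapping.keys (p - q) \<subseteq> Poly_Mapping.keys p \<union> Poly_Mapping.keys (q :: 'a \<Rightarrow>\<^sub>0 'b::ab_group_add)"
  by (auto simp: in_keys_iff lookup_minus)

lemma keys_add_nat: 
  "Poly_Mapping.keys (p + q) = Poly_Mapping.keys p \<union> Poly_Mapping.keys (q :: 'a \<Rightarrow>\<^sub>0 nat)"
  by (auto simp: in_keys_iff lookup_add)

lemma polys_0 [simp]: "0 \<in> polys n" and polys_1 [simp]: "1 \<in> polys n"
  by (auto simp: polys_iff)

lemma polys_add [intro]: "p \<in> polys n \<Longrightarrow> q \<in> polys n \<Longrightarrow> p + q \<in> polys n"
  unfolding polys_iff using keys_add[of p q] by blast

lemma polys_minus [intro]: "p \<in> polys n \<Longrightarrow> - p \<in> polys n"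
  unfolding polys_iff keys_minus_general .

lemma polys_diff [intro]: "p \<in> polys n \<Longrightarrow> q \<in> polys n \<Longrightarrow> p - q \<in> polys n"
  unfolding polys_iff using keys_diff_general[of p q] by blast

lemma polys_mult [intro]: assumes "p \<in> polys n" "q \<in> polys n" shows "p * q \<in> polys n"
  unfolding polys_iff
proof
  fix m assume "m \<in> Poly_Mapping.keys (p * q)"
  then obtain a b where "m = a + b" "a \<in> Poly_Mapping.keys p" "b \<in> Poly_Mapping.keys q"
    using keys_mult[of p q] by blast
  then show "Poly_Mapping.keys m \<subseteq> {1..n}"
    using assms by (simp add: polys_iff keys_add_nat)
qed

lemma polys_sum [intro]: "(\<And>i. i \<in> X \<Longrightarrow> f i \<in> polys n) \<Longrightarrow> (\<Sum>i\<in>X. f i) \<in> polys n"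
  by (induction X rule: infinite_finite_induct) auto

lemma polys_single [simp]: "Poly_Mapping.keys m \<subseteq> {1..n} \<Longrightarrow> Poly_Mapping.single m c \<in> polys n"
  by (simp add: polys_iff)

lemma cring_poly_ring: "cring (poly_ring n :: 'k::field mpoly ring)"
proof (rule cringI)
  show "abelian_group (poly_ring n :: 'k mpoly ring)"
  proof (rule abelian_groupI)
    fix x :: "'k mpoly" assume "x \<in> polys n"
    then have "- x \<in> polys n" "- x + x = 0" by auto
    then show "\<exists>y\<in>polys n. y \<oplus>\<^bsub>poly_ring n\<^esub> x = \<zero>\<^bsub>poly_ring n\<^esub>"
      by (intro bexI[of _ "- x"]) (simp_all add: poly_ring_def)
  next
    fix x y :: "'k mpoly" assume "x \<in> polys n" "y \<in> polys n"
    then have "x + y \<in> polys n" by blast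
    then show "x \<oplus>\<^bsub>poly_ring n\<^esub> y \<in> polys n" by (simp add: poly_ring_def)
  next
    have "(0 :: 'k mpoly) \<in> polys n" by simp
    then show "\<zero>\<^bsub>poly_ring n\<^esub> \<in> (polys n :: 'k mpoly set)" by (simp add: poly_ring_def)
  qed (simp_all add: poly_ring_def add_ac)
  show "Group.comm_monoid (poly_ring n :: 'k mpoly ring)"
  proof (rule comm_monoidI)
    fix x y :: "'k mpoly" assume "x \<in> polys n" "y \<in> polys n"
    then have "x * y \<in> polys n" by blast
    then show "x \<otimes>\<^bsub>poly_ring n\<^esub> y \<in> polys n" by (simp add: poly_ring_def)
  next
    have "(1 :: 'k mpoly) \<in> polys n" by simp
    then show "\<one>\<^bsub>poly_ring n\<^esub> \<in> (polys n :: 'k mpoly set)" by (simp add: poly_ring_def)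
  qed (simp_all add: poly_ring_def mult_ac)
qed (simp_all add: poly_ring_def algebra_simps)

lemma lookup_single_mult:
  fixes f :: "'k::field mpoly"
  shows "Poly_Mapping.lookup (Poly_Mapping.single m c * f) (m + k) = c * Poly_Mapping.lookup f k"
  by (simp add: lookup_mult lookup_single when_mult Sum_any_when_equal)

lemma keys_single_mult:
  fixes f :: "'k::field mpoly"
  shows "Poly_Mapping.keys (Poly_Mapping.single m 1 * f) = (+) m ` Poly_Mapping.keys f"
proof
  show "Poly_Mapping.keys (Poly_Mapping.single m 1 * f) \<subseteq> (+) m ` Poly_Mapping.keys f"
    using keys_mult[of "Poly_Mapping.single m 1" f] by auto
  show "(+) m ` Poly_Mapping.keys f \<subseteq> Poly_Mapping.keys (Poly_Mapping.single m 1 * f)"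
    by (auto simp: in_keys_iff lookup_single_mult)
qed

lemma monomial_add_eq_0_iff: "(0 = a + b) \<longleftrightarrow> a = 0 \<and> b = (0 :: nat \<Rightarrow>\<^sub>0 nat)"
proof
  assume "0 = a + b"
  then have "Poly_Mapping.keys a \<union> Poly_Mapping.keys b = {}"
    by (metis keys_add_nat keys_zero)
  then show "a = 0 \<and> b = 0" by simp
qed simp

lemma constant_coeff_mult:
  fixes f g :: "'k::field mpoly"
  shows "Poly_Mapping.lookup (f * g) 0 = Poly_Mapping.lookup f 0 * Poly_Mapping.lookup g 0"
proof -
  have "(\<Sum>q. Poly_Mapping.lookup g q when 0 = l + q) = (Poly_Mapping.lookup g 0 when l = 0)" for l
  proof (cases "l = 0")
    case True then show ?thesis by simp
  next
    case False
    then have "0 \<noteq> l + q" for q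
      unfolding monomial_add_eq_0_iff by simp
    then have "l + q \<noteq> 0" for q by metis
    then show ?thesis using False by simp
  qed
  then show ?thesis by (simp add: lookup_mult mult_when)
qed

definition restrict_keys :: "('a \<Rightarrow> bool) \<Rightarrow> ('a \<Rightarrow>\<^sub>0 'b::zero) \<Rightarrow> 'a \<Rightarrow>\<^sub>0 'b" where
  "restrict_keys Q p = Poly_Mapping.mapp (\<lambda>k c. if Q k then c else 0) p"

lemma lookup_restrict_keys: 
  "Poly_Mapping.lookup (restrict_keys Q p) k = (if Q k then Poly_Mapping.lookup p k else 0)"
  by (auto simp: restrict_keys_def lookup_mapp when_def in_keys_iff)

lemma keys_restrict_keys: "Poly_Mapping.keys (restrict_keys Q p) = {k \<in> Poly_Mapping.keys p. Q k}"
  by (auto simp: in_keys_iff lookup_restrict_keys split: if_splits)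

lemma restrict_keys_add: 
  "restrict_keys Q (p + q) = restrict_keys Q p + restrict_keys Q (q :: 'a \<Rightarrow>\<^sub>0 'b::monoid_add)"
  by (rule poly_mapping_eqI) (simp add: lookup_restrict_keys lookup_add)

lemma restrict_keys_zero [simp]: "restrict_keys Q 0 = 0"
  by (rule poly_mapping_eqI) (simp add: lookup_restrict_keys)

lemma restrict_keys_sum: 
  "restrict_keys Q (\<Sum>i\<in>X. f i) = (\<Sum>i\<in>X. restrict_keys Q (f i :: 'a \<Rightarrow>\<^sub>0 'b::comm_monoid_add))"
  by (induction X rule: infinite_finite_induct) (simp_all add: restrict_keys_add)

lemma restrict_keys_id: "(\<And>k. k \<in> Poly_Mapping.keys p \<Longrightarrow> Q k) \<Longrightarrow> restrict_keys Q p = p"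
  by (rule poly_mapping_eqI) (auto simp: lookup_restrict_keys in_keys_iff)

lemma restrict_keys_eq_0: "(\<And>k. k \<in> Poly_Mapping.keys p \<Longrightarrow> \<not> Q k) \<Longrightarrow> restrict_keys Q p = 0"
  by (rule poly_mapping_eqI) (auto simp: lookup_restrict_keys in_keys_iff)

lemma polys_restrict_keys [intro]: "p \<in> polys n \<Longrightarrow> restrict_keys Q p \<in> polys n"
  by (auto simp: polys_iff keys_restrict_keys)

text \<open>
  Taking homogeneous components is the special case in which \<open>Q\<close> and \<open>R\<close> prescribe degrees that
  differ by the degree of \<open>g\<close>.  Stating it with predicates on exponents avoids subtracting degrees.
\<close>

lemma restrict_keys_mult:
  fixes p g :: "'k::field mpoly"
  assumes "\<And>a k. k \<in> Poly_Mapping.keys g \<Longrightarrow> Q (a + k) \<longleftrightarrow> R a"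
  shows "restrict_keys Q (p * g) = restrict_keys R p * g"
proof -
  have split: "p = restrict_keys R p + restrict_keys (\<lambda>k. \<not> R k) p"
    by (rule poly_mapping_eqI) (simp add: lookup_restrict_keys lookup_add)
  have a: "restrict_keys Q (restrict_keys R p * g) = restrict_keys R p * g"
  proof (rule restrict_keys_id)
    fix k assume "k \<in> Poly_Mapping.keys (restrict_keys R p * g)"
    then obtain a b where "k = a + b" "a \<in> Poly_Mapping.keys (restrict_keys R p)" "b \<in> Poly_Mapping.keys g"
      using keys_mult by blast
    then show "Q k" using assms by (simp add: keys_restrict_keys)
  qed
  have b: "restrict_keys Q (restrict_keys (\<lambda>k. \<not> R k) p * g) = 0"
  proof (rule restrict_keys_eq_0)
    fix k assume "k \<in> Poly_Mapping.keys (restrict_keys (\<lambda>k. \<not> R k) p * g)"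
    then obtain a b where "k = a + b" "a \<in> Poly_Mapping.keys (restrict_keys (\<lambda>k. \<not> R k) p)" "b \<in> Poly_Mapping.keys g"
      using keys_mult by blast
    then show "\<not> Q k" using assms by (simp add: keys_restrict_keys)
  qed
  have "restrict_keys Q (p * g) = restrict_keys Q ((restrict_keys R p + restrict_keys (\<lambda>k. \<not> R k) p) * g)"
    using split by simp
  then show ?thesis
    using a b by (simp add: restrict_keys_add distrib_right)
qed

lemma monom_degree_superset:
  assumes "finite X" "Poly_Mapping.keys m \<subseteq> X"
  shows "monom_degree m = (\<Sum>i\<in>X. Poly_Mapping.lookup m i)"
  unfolding monom_degree_def using assms
  by (intro sum.mono_neutral_left) (auto simp: in_keys_iff)

lemma monom_degree_add: "monom_degree (a + b) = monom_degree a + monom_degree b"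
proof -
  let ?X = "Poly_Mapping.keys a \<union> Poly_Mapping.keys b"
  have "monom_degree m = (\<Sum>i\<in>?X. Poly_Mapping.lookup m i)" if "m \<in> {a, b, a + b}" for m
    using that by (intro monom_degree_superset) (auto simp: keys_add_nat)
  then show ?thesis by (simp add: lookup_add sum.distrib)
qed

lemma monom_degree_eq_0_iff: "monom_degree m = 0 \<longleftrightarrow> m = 0"
proof
  assume "monom_degree m = 0"
  then have "Poly_Mapping.keys m = {}"
    unfolding monom_degree_def by (metis all_not_in_conv finite_keys in_keys_iff sum_eq_0_iff)
  then show "m = 0" by simp
qed (simp add: monom_degree_def)

lemma monom_degree_single [simp]: "monom_degree (Poly_Mapping.single i c) = c"
  by (cases "c = 0") (auto simp: monom_degree_def)

section \<open>Modules with linear quotients\<close>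

text \<open>
  Vectors with \<open>r\<close> coordinates are functions that vanish from index \<open>r\<close> on, so that the free module
  of rank \<open>r\<close> is contained in the one of rank \<open>r + 1\<close>; inductions over the number of generators
  rely on this inclusion.
\<close>

definition vecs :: "nat \<Rightarrow> nat \<Rightarrow> (nat \<Rightarrow> 'k::field mpoly) set" where
  "vecs n r = {v. (\<forall>s < r. v s \<in> polys n) \<and> (\<forall>s \<ge> r. v s = 0)}"

text \<open>
  The row vector \<open>v\<close> times the matrix with rows \<open>G 0, \<dots>, G (r - 1)\<close>.
\<close>

definition lincomb :: "nat \<Rightarrow> (nat \<Rightarrow> nat \<Rightarrow> 'k::field mpoly) \<Rightarrow> (nat \<Rightarrow> 'k mpoly) \<Rightarrow> nat \<Rightarrow> 'k mpoly" where
  "lincomb r G v = (\<lambda>t. \<Sum>s<r. v s * G s t)"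

definition span_of :: "nat \<Rightarrow> nat \<Rightarrow> (nat \<Rightarrow> nat \<Rightarrow> 'k::field mpoly) \<Rightarrow> (nat \<Rightarrow> 'k mpoly) set" where
  "span_of n r G = lincomb r G ` vecs n r"

definition syzygies :: "nat \<Rightarrow> nat \<Rightarrow> (nat \<Rightarrow> nat \<Rightarrow> 'k::field mpoly) \<Rightarrow> (nat \<Rightarrow> 'k mpoly) set" where
  "syzygies n r G = {v \<in> vecs n r. lincomb r G v = (\<lambda>_. 0)}"

text \<open>
  Here \<open>\<sigma> t\<close> is the degree of the \<open>t\<close>-th basis element of the free module.
\<close>

definition homogeneous_vec :: "(nat \<Rightarrow> nat) \<Rightarrow> nat \<Rightarrow> (nat \<Rightarrow> 'k::field mpoly) \<Rightarrow> bool" where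
  "homogeneous_vec \<sigma> e g \<longleftrightarrow> (\<forall>t. \<forall>m \<in> Poly_Mapping.keys (g t). monom_degree m + \<sigma> t = e)"

definition varideal :: "nat \<Rightarrow> nat set \<Rightarrow> 'k::field mpoly set" where
  "varideal n A = {f \<in> polys n. \<forall>m \<in> Poly_Mapping.keys f. \<exists>p \<in> A. p \<in> Poly_Mapping.keys m}"

text \<open>
  For ideals, i.e. vectors with one coordinate, this is the usual notion of linear quotients,
  restricted to colon ideals generated by variables instead of arbitrary linear forms; for ideals
  generated by monomials this is no restriction.
\<close>

definition linear_quotients :: 
    "nat \<Rightarrow> (nat \<Rightarrow> nat) \<Rightarrow> nat \<Rightarrow> nat \<Rightarrow> (nat \<Rightarrow> nat \<Rightarrow> 'k::field mpoly) \<Rightarrow> bool" where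
  "linear_quotients n \<sigma> m r G \<longleftrightarrow>
     (\<forall>i<r. homogeneous_vec \<sigma> m (G i) \<and> 
        (\<exists>A \<subseteq> {1..n}. \<forall>f \<in> polys n. (\<lambda>t. f * G i t) \<in> span_of n i G \<longleftrightarrow> f \<in> varideal n A))"

definition linear_module :: "nat \<Rightarrow> (nat \<Rightarrow> nat) \<Rightarrow> nat \<Rightarrow> (nat \<Rightarrow> 'k::field mpoly) set \<Rightarrow> bool" where
  "linear_module n \<sigma> m M \<longleftrightarrow> (\<exists>r G. linear_quotients n \<sigma> m r G \<and> M = span_of n r G)"

lemma vecs_0: "vecs n 0 = {\<lambda>_. 0}"
  by (auto simp: vecs_def)

lemma vecs_polys: "v \<in> vecs n r \<Longrightarrow> v s \<in> polys n"
  by (cases "s < r") (auto simp: vecs_def)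

lemma vecs_mono: "v \<in> vecs n r \<Longrightarrow> r \<le> r' \<Longrightarrow> v \<in> vecs n r'"
  using vecs_polys by (auto simp: vecs_def)

lemma vecs_add: "u \<in> vecs n r \<Longrightarrow> v \<in> vecs n r \<Longrightarrow> (\<lambda>t. u t + v t) \<in> vecs n r"
  by (auto simp: vecs_def)

lemma vecs_diff: "u \<in> vecs n r \<Longrightarrow> v \<in> vecs n r \<Longrightarrow> (\<lambda>t. u t - v t) \<in> vecs n r"
  by (auto simp: vecs_def)

lemma vecs_scale: "f \<in> polys n \<Longrightarrow> v \<in> vecs n r \<Longrightarrow> (\<lambda>t. f * v t) \<in> vecs n r"
  by (auto simp: vecs_def)

lemma vecs_unit: "s < r \<Longrightarrow> (\<lambda>t. if t = s then 1 else 0) \<in> vecs n r"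
  by (auto simp: vecs_def)

lemma vecs_restrict_keys: "v \<in> vecs n r \<Longrightarrow> (\<lambda>t. restrict_keys Q (v t)) \<in> vecs n r"
  by (auto simp: vecs_def)

lemma vecs_lincomb: 
  assumes "v \<in> vecs n r" "\<And>s. s < r \<Longrightarrow> G s \<in> vecs n q" shows "lincomb r G v \<in> vecs n q"
  unfolding vecs_def lincomb_def 
proof (clarsimp, intro conjI allI impI)
  fix t
  show "(\<Sum>s<r. v s * G s t) \<in> polys n"
    using assms(2) by (auto intro!: polys_sum polys_mult vecs_polys[OF assms(1)] dest: vecs_polys)
next
  fix t assume "q \<le> t"
  then show "(\<Sum>s<r. v s * G s t) = 0"
    using assms(2) by (intro sum.neutral) (auto simp: vecs_def)
qed

lemma lincomb_add: "lincomb r G (\<lambda>t. u t + v t) = (\<lambda>t. lincomb r G u t + lincomb r G v t)"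
  by (simp add: lincomb_def distrib_right sum.distrib)

lemma lincomb_diff: "lincomb r G (\<lambda>t. u t - v t) = (\<lambda>t. lincomb r G u t - lincomb r G v t)"
  by (simp add: lincomb_def left_diff_distrib sum_subtractf)

lemma lincomb_minus: "lincomb r G (\<lambda>t. - v t) = (\<lambda>t. - lincomb r G v t)"
  by (simp add: lincomb_def sum_negf)

lemma lincomb_scale: "lincomb r G (\<lambda>t. f * v t) = (\<lambda>t. f * lincomb r G v t)"
  by (simp add: lincomb_def sum_distrib_left mult.assoc)

lemma lincomb_Suc: "lincomb (Suc r) G v = (\<lambda>t. lincomb r G v t + v r * G r t)"
  by (simp add: lincomb_def)

lemma lincomb_cong: "(\<And>s. s < r \<Longrightarrow> u s = v s) \<Longrightarrow> (\<And>s. s < r \<Longrightarrow> G s = H s) \<Longrightarrow> lincomb r G u = lincomb r H v"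
  by (simp add: lincomb_def)

lemma lincomb_unit: "s < r \<Longrightarrow> lincomb r G (\<lambda>t. if t = s then 1 else 0) = G s"
  by (simp add: lincomb_def sum.delta if_distrib[of "\<lambda>x. x * _"] cong: if_cong)

lemma lincomb_unit_matrix: "v \<in> vecs n r \<Longrightarrow> lincomb r (\<lambda>s t. if t = s then 1 else 0) v = v"
  by (auto simp: lincomb_def fun_eq_iff if_distrib[of "\<lambda>x. _ * x"] vecs_def cong: if_cong)

lemma lincomb_lincomb: "lincomb r (\<lambda>s. lincomb q H (B s)) w = lincomb q H (lincomb r B w)"
proof
  fix t
  have "lincomb r (\<lambda>s. lincomb q H (B s)) w t = (\<Sum>s<r. \<Sum>l<q. w s * B s l * H l t)"
    by (simp add: lincomb_def sum_distrib_left mult.assoc)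
  also have "\<dots> = (\<Sum>l<q. \<Sum>s<r. w s * B s l * H l t)"
    by (rule sum.swap)
  also have "\<dots> = lincomb q H (lincomb r B w) t"
    by (simp add: lincomb_def sum_distrib_right)
  finally show "lincomb r (\<lambda>s. lincomb q H (B s)) w t = lincomb q H (lincomb r B w) t" .
qed

lemma span_of_gen: "s < r \<Longrightarrow> G s \<in> span_of n r G"
  unfolding span_of_def by (metis lincomb_unit image_eqI vecs_unit)

lemma span_of_cong: "(\<And>s. s < r \<Longrightarrow> G s = H s) \<Longrightarrow> span_of n r G = span_of n r H"
  unfolding span_of_def by (intro image_cong lincomb_cong) auto

lemma span_of_Suc: 
  "span_of n (Suc r) G = {\<lambda>t. v t + f * G r t | v f. v \<in> span_of n r G \<and> f \<in> polys n}"
proof (intro equalityI subsetI)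
  fix x assume "x \<in> span_of n (Suc r) G"
  then obtain v where v: "v \<in> vecs n (Suc r)" "x = lincomb (Suc r) G v"
    by (auto simp: span_of_def)
  have "v(r := 0) \<in> vecs n r" 
    using v(1) by (auto simp: vecs_def)
  moreover have "lincomb r G v = lincomb r G (v(r := 0))"
    by (rule lincomb_cong) auto
  ultimately have "lincomb r G v \<in> span_of n r G"
    by (auto simp: span_of_def)
  then show "x \<in> {\<lambda>t. v t + f * G r t | v f. v \<in> span_of n r G \<and> f \<in> polys n}"
    using v vecs_polys[OF v(1)] by (auto simp: lincomb_Suc)
next
  fix x assume "x \<in> {\<lambda>t. v t + f * G r t | v f. v \<in> span_of n r G \<and> f \<in> polys n}"
  then obtain w f where w: "w \<in> vecs n r" "f \<in> polys n" "x = (\<lambda>t. lincomb r G w t + f * G r t)"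
    by (auto simp: span_of_def)
  have "w(r := f) \<in> vecs n (Suc r)" 
    using w by (auto simp: vecs_def less_Suc_eq)
  moreover have "lincomb r G (w(r := f)) = lincomb r G w"
    by (rule lincomb_cong) auto
  then have "lincomb (Suc r) G (w(r := f)) = x"
    using w by (simp add: lincomb_Suc)
  ultimately show "x \<in> span_of n (Suc r) G"
    by (auto simp: span_of_def)
qed

lemma linear_module_zero: "linear_module n \<sigma> m {\<lambda>_. 0}"
proof -
  have "span_of n 0 G = {\<lambda>_. 0}" for G :: "nat \<Rightarrow> nat \<Rightarrow> 'a mpoly"
    by (simp add: span_of_def vecs_0 lincomb_def)
  then show ?thesis
    unfolding linear_module_def linear_quotients_def by auto
qed

lemma linear_module_extend:
  assumes "linear_module n \<sigma> m M" "homogeneous_vec \<sigma> m g" "A \<subseteq> {1..n}"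
    and "\<And>f. f \<in> polys n \<Longrightarrow> (\<lambda>t. f * g t) \<in> M \<longleftrightarrow> f \<in> varideal n A"
  shows "linear_module n \<sigma> m {\<lambda>t. v t + f * g t | v f. v \<in> M \<and> f \<in> polys n}"
proof -
  obtain r G where G: "linear_quotients n \<sigma> m r G" "M = span_of n r G"
    using assms(1) by (auto simp: linear_module_def)
  let ?G = "G(r := g)"
  have eq: "span_of n i ?G = span_of n i G" if "i \<le> r" for i
    using that by (intro span_of_cong) auto
  have "linear_quotients n \<sigma> m (Suc r) ?G"
    unfolding linear_quotients_def
  proof (intro allI impI)
    fix i assume "i < Suc r"
    then consider "i < r" | "i = r" by linarith
    then show "homogeneous_vec \<sigma> m (?G i) \<and> 
        (\<exists>A \<subseteq> {1..n}. \<forall>f \<in> polys n. (\<lambda>t. f * ?G i t) \<in> span_of n i ?G \<longleftrightarrow> f \<in> varideal n A)"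
    proof cases
      case 1
      then show ?thesis using G(1) eq[of i] by (auto simp: linear_quotients_def)
    next
      case 2
      then show ?thesis using assms(2-4) G(2) eq[of r] by auto
    qed
  qed
  moreover have "span_of n (Suc r) ?G = {\<lambda>t. v t + f * g t | v f. v \<in> M \<and> f \<in> polys n}"
    unfolding span_of_Suc using eq[of r] G(2) by simp
  ultimately show ?thesis
    unfolding linear_module_def by blast
qed

text \<open>
  Comparing homogeneous components of degree \<open>e\<close> on both sides of \<open>\<Sum> v\<^sub>s G\<^sub>s = g\<close>: the coefficients
  of a homogeneous element with respect to generators of degree \<open>m\<close> may be taken homogeneous of
  degree \<open>e - m\<close>.  For \<open>e < m\<close> the predicate is unsatisfiable, and the coefficients become 0.
\<close>

lemma homogeneous_coefficients:
  assumes "\<And>i. i < r \<Longrightarrow> homogeneous_vec \<sigma> m (G i)" "homogeneous_vec \<sigma> e (lincomb r G v)"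
  shows "lincomb r G (\<lambda>s. restrict_keys (\<lambda>k. monom_degree k + m = e) (v s)) = lincomb r G v"
proof
  fix t
  let ?Q = "\<lambda>k. monom_degree k + \<sigma> t = e" and ?R = "\<lambda>k. monom_degree k + m = e"
  have "lincomb r G v t = restrict_keys ?Q (lincomb r G v t)"
    using assms(2) by (intro restrict_keys_id[symmetric]) (auto simp: homogeneous_vec_def)
  also have "\<dots> = (\<Sum>s<r. restrict_keys ?Q (v s * G s t))"
    by (simp add: lincomb_def restrict_keys_sum)
  also have "\<dots> = (\<Sum>s<r. restrict_keys ?R (v s) * G s t)"
  proof (rule sum.cong)
    fix s assume "s \<in> {..<r}"
    then have "homogeneous_vec \<sigma> m (G s)" using assms(1) by simp
    then show "restrict_keys ?Q (v s * G s t) = restrict_keys ?R (v s) * G s t"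
      by (intro restrict_keys_mult) (auto simp: homogeneous_vec_def monom_degree_add)
  qed simp
  finally show "lincomb r G (\<lambda>s. restrict_keys ?R (v s)) t = lincomb r G v t"
    by (simp add: lincomb_def)
qed

lemma varideal_empty: "varideal n {} = {0 :: 'k::field mpoly}"
proof -
  have "f = 0" if "f \<in> varideal n {}" for f :: "'k mpoly"
    using that by (auto simp: varideal_def simp flip: keys_eq_empty)
  then show ?thesis by (auto simp: varideal_def)
qed

lemma varideal_split:
  fixes a :: "'k::field mpoly"
  assumes "a \<in> varideal n (insert p T)"
  obtains b c where "b \<in> varideal n T" "c \<in> polys n" "a = b + c * Poly_Mapping.single (Poly_Mapping.single p 1) 1"
proof -
  let ?Q = "\<lambda>m. \<exists>q\<in>T. q \<in> Poly_Mapping.keys m" and ?e = "Poly_Mapping.single p 1 :: nat \<Rightarrow>\<^sub>0 nat"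
  define b where "b = restrict_keys ?Q a"
  define b' where "b' = restrict_keys (\<lambda>m. \<not> ?Q m) a"
  \<comment> \<open>the remaining part is divisible by \<open>x\<^sub>p\<close>; \<open>c\<close> is the quotient\<close>
  define c where "c = Poly_Mapping.map_key (\<lambda>k. ?e + k) b'"
  have lc: "Poly_Mapping.lookup c k = Poly_Mapping.lookup b' (?e + k)" for k
    by (simp add: c_def map_key.rep_eq inj_on_def)
  have ab: "a = b + b'"
    by (rule poly_mapping_eqI) (simp add: b_def b'_def lookup_restrict_keys lookup_add)
  have b: "b \<in> varideal n T"
    using assms by (auto simp: varideal_def b_def keys_restrict_keys)
  have p: "p \<in> Poly_Mapping.keys k" if "k \<in> Poly_Mapping.keys b'" for k
    using that assms by (auto simp: varideal_def b'_def keys_restrict_keys)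
  have sub: "?e + (k - ?e) = k" if "p \<in> Poly_Mapping.keys k" for k :: "nat \<Rightarrow>\<^sub>0 nat"
    using that 
    by (intro poly_mapping_eqI) (auto simp: lookup_add lookup_minus lookup_single in_keys_iff when_def)
  have b': "b' = Poly_Mapping.single ?e 1 * c"
  proof (rule poly_mapping_eqI)
    fix k
    show "Poly_Mapping.lookup b' k = Poly_Mapping.lookup (Poly_Mapping.single ?e 1 * c) k"
    proof (cases "p \<in> Poly_Mapping.keys k")
      case True
      then show ?thesis
        using lookup_single_mult[of ?e 1 c "k - ?e"] sub[OF True] by (simp add: lc)
    next
      case False
      then have "k \<notin> Poly_Mapping.keys b'" using p by blast
      moreover have "k \<notin> Poly_Mapping.keys (Poly_Mapping.single ?e 1 * c)"
        using False by (auto simp: keys_single_mult keys_add_nat)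
      ultimately show ?thesis by (simp add: in_keys_iff)
    qed
  qed
  have "b' \<in> polys n" 
    using assms by (auto simp: b'_def varideal_def)
  moreover have "?e + k \<in> Poly_Mapping.keys b'" if "k \<in> Poly_Mapping.keys c" for k
    using that by (simp add: in_keys_iff lc)
  ultimately have "c \<in> polys n"
    unfolding polys_iff by (metis Un_subset_iff keys_add_nat)
  then show ?thesis using that b ab b' by (simp add: mult.commute)
qed

lemma varideal_add: "f \<in> varideal n A \<Longrightarrow> g \<in> varideal n A \<Longrightarrow> f + g \<in> varideal n A"
  unfolding varideal_def using keys_add[of f g] by blast

lemma varideal_mult: 
  assumes "f \<in> varideal n A" "g \<in> polys n" shows "g * f \<in> varideal n A"
  using assms unfolding varideal_def 
  by (fastforce dest!: subsetD[OF keys_mult] simp: keys_add_nat)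

lemma var_in_varideal: 
  "p \<in> A \<Longrightarrow> A \<subseteq> {1..n} \<Longrightarrow> Poly_Mapping.single (Poly_Mapping.single p 1) 1 \<in> varideal n A"
  by (auto simp: varideal_def subset_iff)

lemma varideal_colon_var:
  fixes f :: "'k::field mpoly"
  assumes "p \<notin> T" "f \<in> polys n" "Poly_Mapping.single (Poly_Mapping.single p 1) 1 * f \<in> varideal n T"
  shows "f \<in> varideal n T"
proof -
  have "\<exists>q\<in>T. q \<in> Poly_Mapping.keys m" if "m \<in> Poly_Mapping.keys f" for m
  proof -
    have "Poly_Mapping.single p 1 + m \<in> Poly_Mapping.keys (Poly_Mapping.single (Poly_Mapping.single p 1) 1 * f)"
      using that by (simp add: keys_single_mult)
    then obtain q where "q \<in> T" "q \<in> Poly_Mapping.keys (Poly_Mapping.single p 1 + m)"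
      using assms(3) by (auto simp: varideal_def)
    then show ?thesis using assms(1) by (auto simp: keys_add_nat split: if_splits)
  qed
  then show ?thesis using assms(2) by (simp add: varideal_def)
qed

section \<open>Syzygies of modules with linear quotients\<close>

lemma syzygies_iff: "v \<in> syzygies n r G \<longleftrightarrow> v \<in> vecs n r \<and> lincomb r G v = (\<lambda>_. 0)"
  by (simp add: syzygies_def)

lemma syzygies_scale: "f \<in> polys n \<Longrightarrow> v \<in> syzygies n r G \<Longrightarrow> (\<lambda>t. f * v t) \<in> syzygies n r G"
  by (simp add: syzygies_iff vecs_scale lincomb_scale)

lemma syzygies_add: "u \<in> syzygies n r G \<Longrightarrow> v \<in> syzygies n r G \<Longrightarrow> (\<lambda>t. u t + v t) \<in> syzygies n r G"
  by (simp add: syzygies_iff vecs_add lincomb_add)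

lemma syzygies_diff: "u \<in> syzygies n r G \<Longrightarrow> v \<in> syzygies n r G \<Longrightarrow> (\<lambda>t. u t - v t) \<in> syzygies n r G"
  by (simp add: syzygies_iff vecs_diff lincomb_diff)

lemma syzygies_Suc_no_last: "v \<in> syzygies n (Suc r) G \<and> v r = 0 \<longleftrightarrow> v \<in> syzygies n r G"
proof
  assume v: "v \<in> syzygies n (Suc r) G \<and> v r = 0"
  then have "v \<in> vecs n r"
    by (auto simp: syzygies_iff vecs_def) (metis Suc_leI le_neq_implies_less)
  then show "v \<in> syzygies n r G" using v by (auto simp: syzygies_iff lincomb_Suc)
next
  assume v: "v \<in> syzygies n r G"
  then have "v r = 0" "v \<in> vecs n (Suc r)"
    using vecs_mono[of v n r "Suc r"] by (auto simp: syzygies_iff vecs_def)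
  then show "v \<in> syzygies n (Suc r) G \<and> v r = 0" using v by (simp add: syzygies_iff lincomb_Suc)
qed

text \<open>
  Induction on the number of generators.  The syzygies of \<open>G 0, \<dots>, G r\<close> whose last coordinate
  vanishes are those of \<open>G 0, \<dots>, G (r - 1)\<close>, and the last coordinates of all of them form the
  colon ideal, which is generated by the variables in a set \<open>A\<close>.  Interpolate by the modules \<open>M T\<close>
  of syzygies with last coordinate in the ideal generated by the variables in \<open>T \<subseteq> A\<close>: adding a
  variable \<open>x\<^sub>p\<close> to \<open>T\<close> adds one generator, with last coordinate \<open>x\<^sub>p\<close>, and its multiple by \<open>f\<close> lies
  in \<open>M T\<close> iff \<open>f x\<^sub>p\<close>, equivalently \<open>f\<close>, lies in the prime ideal generated by \<open>T\<close>.
\<close>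

lemma syzygies_linear:
  fixes G :: "nat \<Rightarrow> nat \<Rightarrow> 'k::field mpoly"
  assumes "linear_quotients n \<sigma> m r G"
  shows "linear_module n (\<lambda>_. m) (m + 1) (syzygies n r G)"
  using assms
proof (induction r)
  case 0
  have "syzygies n 0 G = {\<lambda>_. 0}"
    by (auto simp: syzygies_def vecs_0 lincomb_def)
  then show ?case by (simp add: linear_module_zero)
next
  case (Suc r)
  have G: "homogeneous_vec \<sigma> m (G i)" if "i < Suc r" for i
    using Suc.prems that by (simp add: linear_quotients_def)
  obtain A where A: "A \<subseteq> {1..n}" 
    "\<And>f. f \<in> polys n \<Longrightarrow> (\<lambda>t. f * G r t) \<in> span_of n r G \<longleftrightarrow> f \<in> varideal n A"
    using Suc.prems by (auto simp: linear_quotients_def)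
  define X :: "nat \<Rightarrow> 'k mpoly" where "X p = Poly_Mapping.single (Poly_Mapping.single p 1) 1" for p
  have X: "X p \<in> varideal n A" if "p \<in> A" for p
    using var_in_varideal[OF that A(1)] by (simp add: X_def)
  have "\<exists>u \<in> vecs n r. lincomb r G u = (\<lambda>t. X p * G r t) \<and> (\<forall>s. \<forall>k \<in> Poly_Mapping.keys (u s). monom_degree k = 1)"
    if p: "p \<in> A" for p
  proof -
    have "(\<lambda>t. X p * G r t) \<in> span_of n r G"
      using A(2)[of "X p"] X[OF p] by (simp add: varideal_def)
    then obtain u where u: "u \<in> vecs n r" "lincomb r G u = (\<lambda>t. X p * G r t)"
      by (auto simp: span_of_def)
    let ?u = "\<lambda>s. restrict_keys (\<lambda>k. monom_degree k + m = m + 1) (u s)"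
    have "homogeneous_vec \<sigma> (m + 1) (lincomb r G u)"
      using G[of r] unfolding u(2) 
      by (auto simp: homogeneous_vec_def X_def keys_single_mult monom_degree_add)
    then have "lincomb r G ?u = lincomb r G u"
      using G by (intro homogeneous_coefficients[of r \<sigma>]) auto
    then show ?thesis
      using u vecs_restrict_keys[OF u(1)] by (intro bexI[of _ ?u]) (auto simp: keys_restrict_keys)
  qed
  then obtain u where u: "\<And>p. p \<in> A \<Longrightarrow> u p \<in> vecs n r" 
    "\<And>p. p \<in> A \<Longrightarrow> lincomb r G (u p) = (\<lambda>t. X p * G r t)"
    "\<And>p s k. p \<in> A \<Longrightarrow> k \<in> Poly_Mapping.keys (u p s) \<Longrightarrow> monom_degree k = 1"
    by metis
  \<comment> \<open>the linear syzygy with leading term \<open>x\<^sub>p e\<^sub>r\<close>\<close>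
  define g where "g p = (\<lambda>s. if s = r then X p else - u p s)" for p
  have g_syzygy: "g p \<in> syzygies n (Suc r) G" if p: "p \<in> A" for p
  proof -
    have "lincomb r G (g p) = lincomb r G (\<lambda>s. - u p s)"
      by (rule lincomb_cong) (auto simp: g_def)
    moreover have "X p \<in> polys n" using X[OF p] by (simp add: varideal_def)
    ultimately show ?thesis
      using u(1,2)[OF p] vecs_polys[OF u(1)[OF p]] 
      by (auto simp: syzygies_iff lincomb_Suc lincomb_minus g_def vecs_def)
  qed
  define M where "M T = {v \<in> syzygies n (Suc r) G. v r \<in> varideal n T}" for T
  have "linear_module n (\<lambda>_. m) (m + 1) (M T)" if "finite T" "T \<subseteq> A" for T
    using that
  proof (induction T)
    case empty
    have "M {} = syzygies n r G"
      unfolding M_def varideal_empty using syzygies_Suc_no_last[of _ n r G] by auto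
    then show ?case using Suc by (simp add: linear_quotients_def)
  next
    case (insert p T)
    have "{\<lambda>t. v t + f * g p t | v f. v \<in> M T \<and> f \<in> polys n} = M (insert p T)"
    proof (intro equalityI subsetI)
      fix x assume "x \<in> {\<lambda>t. v t + f * g p t | v f. v \<in> M T \<and> f \<in> polys n}"
      then obtain v f where vf: "v \<in> M T" "f \<in> polys n" "x = (\<lambda>t. v t + f * g p t)" by blast
      have "X p \<in> varideal n (insert p T)"
        unfolding X_def using insert.prems A(1) by (intro var_in_varideal) blast+
      moreover have "v r \<in> varideal n (insert p T)"
        using vf(1) by (auto simp: M_def varideal_def)
      ultimately have "x r \<in> varideal n (insert p T)"
        unfolding vf(3) g_def using vf(2) by (auto intro: varideal_add varideal_mult)
      then show "x \<in> M (insert p T)"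
        using vf g_syzygy insert.prems unfolding M_def 
        by (auto intro!: syzygies_add syzygies_scale)
    next
      fix x assume x: "x \<in> M (insert p T)"
      then obtain b c where bc: "b \<in> varideal n T" "c \<in> polys n" "x r = b + c * X p"
        unfolding M_def X_def by (auto elim: varideal_split)
      have "(\<lambda>t. x t - c * g p t) \<in> M T"
        using x bc g_syzygy insert.prems unfolding M_def 
        by (auto intro!: syzygies_diff syzygies_scale simp: g_def)
      then show "x \<in> {\<lambda>t. v t + f * g p t | v f. v \<in> M T \<and> f \<in> polys n}"
        using bc(2) by (intro CollectI exI[of _ "\<lambda>t. x t - c * g p t"] exI[of _ c]) auto
    qed
    moreover have "linear_module n (\<lambda>_. m) (m + 1) {\<lambda>t. v t + f * g p t | v f. v \<in> M T \<and> f \<in> polys n}"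
    proof (rule linear_module_extend[where A = T])
      show "linear_module n (\<lambda>_. m) (m + 1) (M T)" using insert by simp
      show "homogeneous_vec (\<lambda>_. m) (m + 1) (g p)"
        using u(3)[of p] insert.prems by (auto simp: homogeneous_vec_def g_def X_def keys_minus_general)
      show "T \<subseteq> {1..n}" using insert.prems A(1) by auto
      fix f :: "'k mpoly" assume f: "f \<in> polys n"
      have "X p \<in> polys n" using X[of p] insert.prems by (simp add: varideal_def)
      then have "X p * f \<in> varideal n T \<longleftrightarrow> f \<in> varideal n T"
        using varideal_colon_var[OF insert.hyps(2) f] varideal_mult[of f n T "X p"] 
        unfolding X_def by blast
      moreover have "(\<lambda>t. f * g p t) \<in> syzygies n (Suc r) G"
        using syzygies_scale[OF f g_syzygy] insert.prems by blast
      ultimately show "(\<lambda>t. f * g p t) \<in> M T \<longleftrightarrow> f \<in> varideal n T"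
        by (simp add: M_def g_def mult.commute)
    qed
    ultimately show ?case by simp
  qed
  moreover have "finite A" using A(1) finite_subset by blast
  moreover have "M A = syzygies n (Suc r) G"
  proof -
    have "v r \<in> varideal n A" if v: "v \<in> syzygies n (Suc r) G" for v
    proof -
      define w where "w = (\<lambda>s. if s = r then 0 else - v s)"
      have "w \<in> vecs n r" using v by (auto simp: w_def syzygies_iff vecs_def)
      moreover have "lincomb r G w = lincomb r G (\<lambda>s. - v s)"
        by (rule lincomb_cong) (auto simp: w_def)
      then have "lincomb r G w = (\<lambda>t. v r * G r t)"
        using v by (simp add: syzygies_iff lincomb_Suc lincomb_minus fun_eq_iff add_eq_0_iff)
      ultimately have "(\<lambda>t. v r * G r t) \<in> span_of n r G"
        unfolding span_of_def by (metis image_eqI)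
      moreover have "v r \<in> polys n" using v vecs_polys by (auto simp: syzygies_iff)
      ultimately show ?thesis using A(2) by blast
    qed
    then show ?thesis by (auto simp: M_def)
  qed
  ultimately show ?case by force
qed

text \<open>
  Generators with linear quotients are a minimal system of generators, as their syzygies are
  generated by linear ones.
\<close>

lemma constant_coeff_syzygy:
  fixes G :: "nat \<Rightarrow> nat \<Rightarrow> 'k::field mpoly"
  assumes "linear_quotients n \<sigma> m r G" "v \<in> syzygies n r G"
  shows "Poly_Mapping.lookup (v s) 0 = 0"
proof -
  obtain r' G' where G': "linear_quotients n (\<lambda>_. m) (m + 1) r' G'" "syzygies n r G = span_of n r' G'"
    using syzygies_linear[OF assms(1)] by (auto simp: linear_module_def)
  then obtain w where "v = lincomb r' G' w" using assms(2) by (auto simp: span_of_def)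
  moreover have "Poly_Mapping.lookup (G' i s) 0 = 0" if "i < r'" for i
  proof -
    have "homogeneous_vec (\<lambda>_. m) (m + 1) (G' i)" using G' that by (simp add: linear_quotients_def)
    then have "0 \<notin> Poly_Mapping.keys (G' i s)"
      unfolding homogeneous_vec_def using monom_degree_eq_0_iff[of 0] by fastforce
    then show ?thesis by (simp add: in_keys_iff)
  qed
  ultimately show ?thesis by (simp add: lincomb_def lookup_sum constant_coeff_mult)
qed

lemma span_of_subset_vecs: "(\<And>s. s < r \<Longrightarrow> G s \<in> vecs n q) \<Longrightarrow> span_of n r G \<subseteq> vecs n q"
  by (auto simp: span_of_def intro: vecs_lincomb)

text \<open>
  If \<open>a\<close> and \<open>b\<close> are matrices of constants with \<open>G = a h\<close> and \<open>h = b G\<close>, the rows of \<open>b a - 1\<close> are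
  constant syzygies of \<open>h\<close>; by minimality of \<open>h\<close> they vanish.
\<close>

lemma inverse_matrices:
  fixes h :: "nat \<Rightarrow> nat \<Rightarrow> 'k::field mpoly"
  assumes a: "\<And>i. i < r \<Longrightarrow> a i \<in> vecs n q" "\<And>i j k. i < r \<Longrightarrow> k \<in> Poly_Mapping.keys (a i j) \<Longrightarrow> k = 0"
    "\<And>i. i < r \<Longrightarrow> lincomb q h (a i) = G i"
    and b: "\<And>j. j < q \<Longrightarrow> b j \<in> vecs n r" "\<And>i j k. j < q \<Longrightarrow> k \<in> Poly_Mapping.keys (b j i) \<Longrightarrow> k = 0"
    "\<And>j. j < q \<Longrightarrow> lincomb r G (b j) = h j"
    and min: "\<And>v s. v \<in> syzygies n q h \<Longrightarrow> Poly_Mapping.lookup (v s) 0 = 0"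
    and w: "w \<in> vecs n q"
  shows "lincomb r a (lincomb q b w) = w"
proof -
  have "lincomb r a (b j) = (\<lambda>l. if l = j then 1 else 0)" if j: "j < q" for j
  proof
    fix l
    let ?v = "\<lambda>l. lincomb r a (b j) l - (if l = j then 1 else 0)"
    have "lincomb r G (b j) = lincomb r (\<lambda>i. lincomb q h (a i)) (b j)"
      using a(3) by (intro lincomb_cong) auto
    then have "lincomb q h (lincomb r a (b j)) = h j"
      using b(3)[OF j] by (simp add: lincomb_lincomb)
    then have "?v \<in> syzygies n q h"
      using j a(1) b(1)[OF j] by (simp add: syzygies_iff lincomb_diff lincomb_unit vecs_diff vecs_lincomb vecs_unit)
    then have "Poly_Mapping.lookup (?v l) 0 = 0" by (rule min)
    moreover have "k = 0" if "k \<in> Poly_Mapping.keys (?v l)" for k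
    proof (rule ccontr)
      assume k: "k \<noteq> 0"
      have "k \<notin> Poly_Mapping.keys (b j i * a i l)" if "i < r" for i
        using keys_mult[of "b j i" "a i l"] a(2)[OF that] b(2)[OF j] k by fastforce
      then have "Poly_Mapping.lookup (?v l) k = 0"
        using k by (auto simp: lincomb_def lookup_minus lookup_sum in_keys_iff lookup_one)
      then show False using that by (simp add: in_keys_iff)
    qed
    ultimately have "Poly_Mapping.keys (?v l) = {}" by (metis all_not_in_conv in_keys_iff)
    then show "lincomb r a (b j) l = (if l = j then 1 else 0)" by simp
  qed
  then have "lincomb q (\<lambda>j. lincomb r a (b j)) w = lincomb q (\<lambda>j l. if l = j then 1 else 0) w"
    by (intro lincomb_cong) auto
  then show ?thesis using w by (simp add: lincomb_lincomb lincomb_unit_matrix)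
qed

text \<open>
  A minimal homogeneous system of generators of a module generated in degree \<open>m\<close> consists of elements
  of degree \<open>m\<close>: a generator of another degree would be a combination of the \<open>G i\<close> whose coefficients have
  no constant term, and rewriting it in terms of \<open>h\<close> gives a syzygy of \<open>h\<close> with a non-zero
  constant term.  Any two such
  systems then differ by an invertible constant matrix, which carries the linear quotients of the
  syzygies of \<open>G\<close> over to those of \<open>h\<close>.
\<close>

lemma minimal_generators_linear:
  fixes h :: "nat \<Rightarrow> nat \<Rightarrow> 'k::field mpoly"
  assumes G: "linear_quotients n \<sigma> m r G"
    and h: "\<And>j. j < q \<Longrightarrow> homogeneous_vec \<sigma> (\<delta> j) (h j)"
    and span: "span_of n q h = span_of n r G"
    and min: "\<And>v s. v \<in> syzygies n q h \<Longrightarrow> Poly_Mapping.lookup (v s) 0 = 0"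
  shows "\<forall>j<q. \<delta> j = m" and "linear_module n \<delta> (m + 1) (syzygies n q h)"
proof -
  have Gm: "\<And>i. i < r \<Longrightarrow> homogeneous_vec \<sigma> m (G i)" using G by (simp add: linear_quotients_def)
  have "\<exists>b \<in> vecs n r. lincomb r G b = h j \<and> (\<forall>i. \<forall>k \<in> Poly_Mapping.keys (b i). monom_degree k + m = \<delta> j)"
    if j: "j < q" for j
  proof -
    have "h j \<in> span_of n r G" using span_of_gen[OF j] span by blast
    then obtain b where b: "b \<in> vecs n r" "lincomb r G b = h j" by (auto simp: span_of_def)
    let ?b = "\<lambda>s. restrict_keys (\<lambda>k. monom_degree k + m = \<delta> j) (b s)"
    have "lincomb r G ?b = h j"
      using homogeneous_coefficients[OF Gm, where e = "\<delta> j" and v = b] h[OF j] b(2) by simp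
    then show ?thesis
      using vecs_restrict_keys[OF b(1)] by (intro bexI[of _ ?b]) (auto simp: keys_restrict_keys)
  qed
  then obtain b where b: "\<And>j. j < q \<Longrightarrow> b j \<in> vecs n r" "\<And>j. j < q \<Longrightarrow> lincomb r G (b j) = h j"
    "\<And>j i k. j < q \<Longrightarrow> k \<in> Poly_Mapping.keys (b j i) \<Longrightarrow> monom_degree k + m = \<delta> j"
    by metis
  have "\<exists>a \<in> vecs n q. lincomb q h a = G i" if i: "i < r" for i
    using span_of_gen[OF i, of G n] unfolding span[symmetric] by (auto simp: span_of_def)
  then obtain a0 where a0: "\<And>i. i < r \<Longrightarrow> a0 i \<in> vecs n q" "\<And>i. i < r \<Longrightarrow> lincomb q h (a0 i) = G i"
    by metis
  have \<delta>: "\<delta> j = m" if j: "j < q" for j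
  proof (rule ccontr)
    assume "\<delta> j \<noteq> m"
    then have "0 \<notin> Poly_Mapping.keys (b j i)" for i
      using b(3)[OF j, of 0 i] monom_degree_eq_0_iff[of 0] by auto
    then have b0: "Poly_Mapping.lookup (b j i) 0 = 0" for i
      by (simp add: in_keys_iff)
    let ?v = "\<lambda>l. lincomb r a0 (b j) l - (if l = j then 1 else 0)"
    have "lincomb r G (b j) = lincomb r (\<lambda>i. lincomb q h (a0 i)) (b j)"
      using a0(2) by (intro lincomb_cong) auto
    then have "lincomb q h (lincomb r a0 (b j)) = h j"
      using b(2)[OF j] by (simp add: lincomb_lincomb)
    then have "?v \<in> syzygies n q h"
      using j a0(1) b(1)[OF j] by (simp add: syzygies_iff lincomb_diff lincomb_unit vecs_diff vecs_lincomb vecs_unit)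
    from min[OF this, of j] show False
      by (simp add: lookup_minus lincomb_def lookup_sum constant_coeff_mult b0)
  qed
  then show "\<forall>j<q. \<delta> j = m" by simp
  have hm: "\<And>j. j < q \<Longrightarrow> homogeneous_vec \<sigma> m (h j)" using h \<delta> by simp
  \<comment> \<open>all degrees are equal now, so homogeneous coefficients are constants\<close>
  define a where "a i s = restrict_keys (\<lambda>k. monom_degree k + m = m) (a0 i s)" for i s
  have a: "\<And>i. i < r \<Longrightarrow> a i \<in> vecs n q" "\<And>i j k. i < r \<Longrightarrow> k \<in> Poly_Mapping.keys (a i j) \<Longrightarrow> k = 0"
    "\<And>i. i < r \<Longrightarrow> lincomb q h (a i) = G i"
  proof -
    fix i assume i: "i < r"
    show "a i \<in> vecs n q" unfolding a_def using a0(1)[OF i] by (rule vecs_restrict_keys)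
    show "k = 0" if "k \<in> Poly_Mapping.keys (a i j)" for j k
      using that by (simp add: a_def keys_restrict_keys monom_degree_eq_0_iff)
    show "lincomb q h (a i) = G i"
      using homogeneous_coefficients[OF hm, where e = m and v = "a0 i"] Gm[OF i] a0(2)[OF i] by (simp add: a_def[abs_def])
  qed
  have b0: "k = 0" if "j < q" "k \<in> Poly_Mapping.keys (b j i)" for i j k
    using b(3)[OF that] \<delta>[OF that(1)] by (simp add: monom_degree_eq_0_iff)
  have ab: "lincomb r a (lincomb q b w) = w" if "w \<in> vecs n q" for w
    by (rule inverse_matrices[where n = n and r = r and q = q and a = a and b = b and G = G and h = h])
      (fact a b(1,2) b0 min that | assumption)+
  have ba: "lincomb q b (lincomb r a v) = v" if "v \<in> vecs n r" for v
    by (rule inverse_matrices[where n = n and r = q and q = r and a = b and b = a and G = h and h = G])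
      (fact a b(1,2) b0 constant_coeff_syzygy[OF G] that | assumption)+
  obtain r' G' where G': "linear_quotients n (\<lambda>_. m) (m + 1) r' G'" "syzygies n r G = span_of n r' G'"
    using syzygies_linear[OF G] by (auto simp: linear_module_def)
  have G'v: "G' i \<in> vecs n r" if "i < r'" for i
    using span_of_gen[OF that, of G' n] G'(2) by (auto simp: syzygies_iff)
  define H where "H i = lincomb r a (G' i)" for i
  have span_H: "span_of n i H = lincomb r a ` span_of n i G'" for i
    unfolding span_of_def H_def image_image lincomb_lincomb ..
  have "syzygies n q h = lincomb r a ` syzygies n r G"
  proof (intro equalityI subsetI)
    fix w assume w: "w \<in> syzygies n q h"
    have "lincomb r G (lincomb q b w) = lincomb q (\<lambda>j. lincomb r G (b j)) w" by (simp add: lincomb_lincomb)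
    also have "\<dots> = lincomb q h w" using b(2) by (intro lincomb_cong) auto
    finally have "lincomb q b w \<in> syzygies n r G"
      using w b(1) by (auto simp: syzygies_iff intro: vecs_lincomb)
    then show "w \<in> lincomb r a ` syzygies n r G"
      using ab[of w] w by (metis image_eqI syzygies_iff)
  next
    fix w assume "w \<in> lincomb r a ` syzygies n r G"
    then obtain v where v: "v \<in> syzygies n r G" "w = lincomb r a v" by blast
    have "lincomb q h w = lincomb r (\<lambda>i. lincomb q h (a i)) v" by (simp add: lincomb_lincomb v(2))
    also have "\<dots> = lincomb r G v" using a(3) by (intro lincomb_cong) auto
    finally show "w \<in> syzygies n q h"
      using v a(1) by (auto simp: syzygies_iff intro: vecs_lincomb)
  qed
  then have "syzygies n q h = span_of n r' H" by (simp add: span_H G'(2))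
  moreover have "linear_quotients n \<delta> (m + 1) r' H"
    unfolding linear_quotients_def
  proof (intro allI impI conjI)
    fix i assume i: "i < r'"
    show "homogeneous_vec \<delta> (m + 1) (H i)"
      unfolding homogeneous_vec_def
    proof (intro allI ballI)
      fix t k assume k: "k \<in> Poly_Mapping.keys (H i t)"
      have "H i \<in> vecs n q" unfolding H_def using G'v[OF i] a(1) by (rule vecs_lincomb)
      then have "t < q" using k by (cases "t < q") (auto simp: vecs_def)
      have "\<exists>s<r. k \<in> Poly_Mapping.keys (G' i s * a s t)"
      proof (rule ccontr)
        assume "\<not> (\<exists>s<r. k \<in> Poly_Mapping.keys (G' i s * a s t))"
        then have "Poly_Mapping.lookup (H i t) k = 0"
          unfolding H_def lincomb_def lookup_sum by (intro sum.neutral) (simp add: in_keys_iff)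
        then show False using k by (simp add: in_keys_iff)
      qed
      then obtain s where s: "s < r" "k \<in> Poly_Mapping.keys (G' i s * a s t)" by blast
      then have "k \<in> Poly_Mapping.keys (G' i s)"
        using keys_mult[of "G' i s" "a s t"] a(2)[OF s(1)] by fastforce
      then show "monom_degree k + \<delta> t = m + 1"
        using G'(1) i \<delta>[OF \<open>t < q\<close>] by (simp add: linear_quotients_def homogeneous_vec_def)
    qed
    have "\<exists>A\<subseteq>{1..n}. \<forall>f\<in>polys n. (\<lambda>t. f * G' i t) \<in> span_of n i G' \<longleftrightarrow> f \<in> varideal n A"
      using G'(1)[unfolded linear_quotients_def, rule_format, OF i] by (rule conjunct2)
    then obtain A where A: "A \<subseteq> {1..n}" 
      "\<And>f. f \<in> polys n \<Longrightarrow> (\<lambda>t. f * G' i t) \<in> span_of n i G' \<longleftrightarrow> f \<in> varideal n A"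
      by (elim exE conjE) simp
    have inj: "inj_on (lincomb r a) (vecs n r)"
      by (rule inj_on_inverseI) (rule ba)
    have sub: "span_of n i G' \<subseteq> vecs n r"
      using i G'v by (intro span_of_subset_vecs) auto
    have "(\<lambda>t. f * H i t) \<in> span_of n i H \<longleftrightarrow> f \<in> varideal n A" if f: "f \<in> polys n" for f
    proof -
      have "(\<lambda>t. f * H i t) = lincomb r a (\<lambda>t. f * G' i t)"
        by (simp add: lincomb_scale H_def)
      then have "(\<lambda>t. f * H i t) \<in> span_of n i H \<longleftrightarrow> (\<lambda>t. f * G' i t) \<in> span_of n i G'"
        unfolding span_H using inj_on_image_mem_iff[OF inj vecs_scale[OF f G'v[OF i]] sub] by simp
      then show ?thesis using A(2)[OF f] by simp
    qed
    then show "\<exists>A\<subseteq>{1..n}. \<forall>f\<in>polys n. ((\<lambda>t. f * H i t) \<in> span_of n i H) = (f \<in> varideal n A)"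
      using A(1) by blast
  qed
  ultimately show "linear_module n \<delta> (m + 1) (syzygies n q h)"
    unfolding linear_module_def by blast
qed

section \<open>Minimal graded free resolutions\<close>

text \<open>
  Ideals are treated as submodules of the free module of rank 1.
\<close>

definition embed_coord0 :: "'k::field mpoly \<Rightarrow> nat \<Rightarrow> 'k mpoly" where
  "embed_coord0 f = (\<lambda>t. if t = 0 then f else 0)"

text \<open>
  The images of the basis elements of the \<open>i\<close>-th free module, as vectors in a uniform way: the
  augmentation becomes the differential in degree 0, with values in the free module of rank 1.
\<close>

definition target :: "'k::field free_complex \<Rightarrow> nat \<Rightarrow> nat \<Rightarrow> nat \<Rightarrow> 'k mpoly" where
  "target F i s = (case i of 0 \<Rightarrow> embed_coord0 (aug F s) 
     | Suc i' \<Rightarrow> (\<lambda>t. if t < rk F i' then mat F i' s t else 0))"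

lemma chains_vecs: "chains n F i = vecs n (rk F i)"
  by (simp add: chains_def vecs_def)

lemma lincomb_target_0: "lincomb (rk F 0) (target F 0) v = embed_coord0 (aug_map F v)"
  by (auto simp: lincomb_def target_def embed_coord0_def aug_map_def fun_eq_iff)

lemma lincomb_target_Suc: "lincomb (rk F (Suc i)) (target F (Suc i)) v = boundary F i v"
  by (auto simp: lincomb_def target_def boundary_def fun_eq_iff)

lemma embed_coord0_eq_iff: "embed_coord0 f = embed_coord0 g \<longleftrightarrow> f = g"
  by (auto simp: embed_coord0_def fun_eq_iff)

lemma embed_coord0_0: "embed_coord0 0 = (\<lambda>_. 0)"
  by (auto simp: embed_coord0_def)

lemma syzygies_target_0: "syzygies n (rk F 0) (target F 0) = {v \<in> chains n F 0. aug_map F v = 0}"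
  by (auto simp: syzygies_def chains_vecs lincomb_target_0 embed_coord0_eq_iff simp flip: embed_coord0_0)

lemma syzygies_target_Suc: 
  "syzygies n (rk F (Suc i)) (target F (Suc i)) = {v \<in> chains n F (Suc i). boundary F i v = (\<lambda>_. 0)}"
  by (simp add: syzygies_def chains_vecs lincomb_target_Suc)

lemma span_target_0: "span_of n (rk F 0) (target F 0) = embed_coord0 ` aug_map F ` chains n F 0"
  by (simp add: span_of_def lincomb_target_0 chains_vecs image_image)

lemma span_target_Suc: "span_of n (rk F (Suc i)) (target F (Suc i)) = boundary F i ` chains n F (Suc i)"
  by (simp add: span_of_def lincomb_target_Suc[abs_def] chains_vecs)

lemma graded_free_resolution_iff:
  "graded_free_resolution n J F \<longleftrightarrow>
     (\<forall>i. \<forall>s < rk F i. (\<forall>t < (if i = 0 then 1 else rk F (i - 1)). target F i s t \<in> polys n) \<and> 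
        homogeneous_vec (if i = 0 then (\<lambda>_. 0) else shift F (i - 1)) (shift F i s) (target F i s)) \<and>
     span_of n (rk F 0) (target F 0) = embed_coord0 ` J \<and>
     (\<forall>i. syzygies n (rk F i) (target F i) = span_of n (rk F (Suc i)) (target F (Suc i)))"
proof -
  have all: "(\<forall>i::nat. P i) \<longleftrightarrow> P 0 \<and> (\<forall>i. P (Suc i))" for P
  proof safe
    fix i assume "P 0" "\<forall>i. P (Suc i)"
    then show "P i" by (cases i) simp_all
  qed simp_all
  have inj: "embed_coord0 ` A = embed_coord0 ` B \<longleftrightarrow> A = B" for A B :: "'a mpoly set"
    by (rule inj_image_eq_iff) (simp add: inj_on_def embed_coord0_eq_iff)
  define A where "A i \<longleftrightarrow> (\<forall>s < rk F i. (\<forall>t < (if i = 0 then 1 else rk F (i - 1)). target F i s t \<in> polys n) \<and> 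
        homogeneous_vec (if i = 0 then (\<lambda>_. 0) else shift F (i - 1)) (shift F i s) (target F i s))" for i
  define B where "B i \<longleftrightarrow> syzygies n (rk F i) (target F i) = span_of n (rk F (Suc i)) (target F (Suc i))" for i
  have A0: "A 0 \<longleftrightarrow> (\<forall>s < rk F 0. aug F s \<in> polys n \<and> homogeneous (shift F 0 s) (aug F s))"
    by (simp add: A_def homogeneous_vec_def homogeneous_def target_def embed_coord0_def)
  have AS: "A (Suc i) \<longleftrightarrow> (\<forall>s < rk F (i + 1). \<forall>t < rk F i. mat F i s t \<in> polys n \<and>
        (\<forall>m \<in> Poly_Mapping.keys (mat F i s t). monom_degree m + shift F i t = shift F (i + 1) s))" for i
    by (auto simp: A_def homogeneous_vec_def target_def)
  have B0: "B 0 \<longleftrightarrow> {v \<in> chains n F 0. aug_map F v = 0} = boundary F 0 ` chains n F 1"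
    by (simp add: B_def syzygies_target_0 span_target_Suc)
  have BS: "B (Suc i) \<longleftrightarrow> {v \<in> chains n F (i + 1). boundary F i v = (\<lambda>_. 0)}
          = boundary F (i + 1) ` chains n F (i + 2)" for i
    by (simp add: B_def syzygies_target_Suc span_target_Suc)
  have "graded_free_resolution n J F \<longleftrightarrow> 
     (A 0 \<and> (\<forall>i. A (Suc i))) \<and> embed_coord0 ` aug_map F ` chains n F 0 = embed_coord0 ` J \<and> (B 0 \<and> (\<forall>i. B (Suc i)))"
    unfolding A0 AS B0 BS inj graded_free_resolution_def by (simp only: conj_assoc)
  then show ?thesis
    unfolding all[of A, symmetric] all[of B, symmetric] unfolding A_def[abs_def] B_def[abs_def] span_target_0 .
qed

text \<open>
  By induction on \<open>i\<close>, the image of the \<open>i\<close>-th differential has linear quotients in degree \<open>m + i\<close>;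
  the next image consists of its syzygies.
\<close>

lemma minimal_resolution_linear:
  assumes F: "minimal_graded_free_resolution n J F" and J: "linear_module n (\<lambda>_. 0) m (embed_coord0 ` J)"
  shows "s < rk F i \<Longrightarrow> shift F i s = m + i"
proof -
  have res: "graded_free_resolution n J F"
    using F by (simp add: minimal_graded_free_resolution_def)
  define \<sigma> where "\<sigma> i = (if i = 0 then (\<lambda>_. 0) else shift F (i - 1))" for i
  have hom: "homogeneous_vec (\<sigma> i) (shift F i s) (target F i s)" if "s < rk F i" for i s
    using res that unfolding graded_free_resolution_iff \<sigma>_def by blast
  have exact: "syzygies n (rk F i) (target F i) = span_of n (rk F (Suc i)) (target F (Suc i))" for i
    using res unfolding graded_free_resolution_iff by blast
  have min: "Poly_Mapping.lookup (v s) 0 = 0" if v: "v \<in> syzygies n (rk F i) (target F i)" for i v s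
  proof -
    obtain w where w: "v = boundary F i w"
      using v unfolding exact span_target_Suc by blast
    have "Poly_Mapping.lookup (mat F i s' t) 0 = 0" if "s' < rk F (i + 1)" "t < rk F i" for s' t
      using F that by (simp add: minimal_graded_free_resolution_def)
    then show ?thesis by (simp add: w boundary_def lookup_sum constant_coeff_mult)
  qed
  have step: "(\<forall>s < rk F i. shift F i s = m + i) \<and> linear_module n (shift F i) (m + i + 1) (syzygies n (rk F i) (target F i))"
    if lin: "linear_module n (\<sigma> i) (m + i) (span_of n (rk F i) (target F i))" for i
  proof -
    obtain r G where G: "linear_quotients n (\<sigma> i) (m + i) r G" "span_of n (rk F i) (target F i) = span_of n r G"
      using lin by (auto simp: linear_module_def)
    note gens = minimal_generators_linear[where h = "target F i" and \<delta> = "shift F i" and q = "rk F i", OF G(1) _ G(2)]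
    show ?thesis
      by (intro conjI gens) (fact hom min | assumption)+
  qed
  have lin: "linear_module n (\<sigma> i) (m + i) (span_of n (rk F i) (target F i))" for i
  proof (induction i)
    case 0
    have "span_of n (rk F 0) (target F 0) = embed_coord0 ` J"
      using res unfolding graded_free_resolution_iff by blast
    then show ?case using J by (simp add: \<sigma>_def)
  next
    case (Suc i)
    then show ?case using step[OF Suc] by (simp add: exact \<sigma>_def)
  qed
  show "s < rk F i \<Longrightarrow> shift F i s = m + i"
    using step[OF lin[of i]] by blast
qed

text \<open>
  The syzygies of generators with linear quotients again have such generators, so a resolution is
  built by dependent choice.  Its matrices have linear entries, hence no constant terms.
\<close>

lemma minimal_resolution_exists:
  assumes J: "linear_module n (\<lambda>_. 0) m (embed_coord0 ` J)" "J \<subseteq> polys n"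
  shows "\<exists>F. minimal_graded_free_resolution n J F"
proof -
  define \<sigma> :: "nat \<Rightarrow> nat \<Rightarrow> nat" where "\<sigma> i = (if i = 0 then (\<lambda>_. 0) else (\<lambda>_. m + (i - 1)))" for i
  define P where "P i = (\<lambda>(r, G). linear_quotients n (\<sigma> i) (m + i) r (G :: nat \<Rightarrow> nat \<Rightarrow> 'a mpoly) \<and> 
      (i = 0 \<longrightarrow> span_of n r G = embed_coord0 ` J))" for i
  define Q where "Q = (\<lambda>(i::nat) (r, G :: nat \<Rightarrow> nat \<Rightarrow> 'a mpoly) (r', G'). syzygies n r G = span_of n r' G')"
  have "\<exists>f. \<forall>i. P i (f i) \<and> Q i (f i) (f (Suc i))"
  proof (rule dependent_nat_choice)
    show "\<exists>x. P 0 x"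
      using J(1) by (auto simp: P_def \<sigma>_def linear_module_def)
  next
    fix x i assume P: "P i x"
    obtain r G where x: "x = (r, G)" by fastforce
    have "linear_module n (\<sigma> (Suc i)) (m + Suc i) (syzygies n r G)"
      using syzygies_linear P by (fastforce simp: P_def x \<sigma>_def)
    then show "\<exists>y. P (Suc i) y \<and> Q i x y"
      by (auto simp: linear_module_def P_def Q_def x)
  qed
  then obtain f where f: "\<And>i. P i (f i)" "\<And>i. Q i (f i) (f (Suc i))" by blast
  define R where "R i = fst (f i)" for i
  define G where "G i = snd (f i)" for i
  have fi: "f i = (R i, G i)" for i by (simp add: R_def G_def)
  have lq: "linear_quotients n (\<sigma> i) (m + i) (R i) (G i)" for i
    using f(1)[of i] by (simp add: P_def fi)
  have J0: "span_of n (R 0) (G 0) = embed_coord0 ` J"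
    using f(1)[of 0] by (simp add: P_def fi)
  have ex: "syzygies n (R i) (G i) = span_of n (R (Suc i)) (G (Suc i))" for i
    using f(2)[of i] by (simp add: Q_def fi)
  define F where "F = \<lparr> rk = R, shift = (\<lambda>i s. m + i), aug = (\<lambda>s. G 0 s 0), mat = (\<lambda>i. G (Suc i)) \<rparr>"
  have G0: "G 0 s = embed_coord0 (G 0 s 0)" "G 0 s 0 \<in> polys n" if "s < R 0" for s
    using span_of_gen[OF that, of "G 0" n] J(2) unfolding J0 by (auto simp: embed_coord0_def)
  have GS: "G (Suc i) s \<in> vecs n (R i)" if "s < R (Suc i)" for i s
    using span_of_gen[OF that, of "G (Suc i)" n] unfolding ex[symmetric] by (simp add: syzygies_iff)
  have t: "target F i s = G i s" if "s < R i" for i s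
  proof (cases i)
    case 0
    then show ?thesis using G0(1)[of s] that by (simp add: target_def F_def)
  next
    case (Suc i')
    then show ?thesis using GS[of s i'] that by (auto simp: target_def F_def vecs_def)
  qed
  have sp: "span_of n (R i) (target F i) = span_of n (R i) (G i)" for i
    by (rule span_of_cong) (rule t)
  have sy: "syzygies n (R i) (target F i) = syzygies n (R i) (G i)" for i
    unfolding syzygies_def using lincomb_cong[of "R i" _ _ "target F i" "G i", OF refl t] by auto
  have [simp]: "rk F = R" "shift F = (\<lambda>i s. m + i)" by (simp_all add: F_def)
  have "graded_free_resolution n J F"
    unfolding graded_free_resolution_iff
  proof (intro conjI allI impI)
    fix i s t assume s: "s < rk F i"
    show "target F i s t \<in> polys n"
    proof (cases i)
      case 0
      then show ?thesis using G0[of s] s t by (simp add: embed_coord0_def) (metis polys_0 embed_coord0_def)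
    next
      case (Suc i')
      then show ?thesis using GS[of s i'] vecs_polys s t by auto
    qed
  next
    fix i s assume s: "s < rk F i"
    have "homogeneous_vec (\<sigma> i) (m + i) (G i s)" using lq[of i] s by (simp add: linear_quotients_def)
    then show "homogeneous_vec (if i = 0 then (\<lambda>_. 0) else shift F (i - 1)) (shift F i s) (target F i s)"
      using t s by (simp add: \<sigma>_def split: if_splits)
  qed (simp_all add: sp sy J0 ex)
  moreover have "Poly_Mapping.lookup (mat F i s t) 0 = 0" if "s < rk F (i + 1)" for i s t
  proof -
    have "homogeneous_vec (\<sigma> (Suc i)) (m + Suc i) (G (Suc i) s)" using lq[of "Suc i"] that by (simp add: linear_quotients_def)
    then have "0 \<notin> Poly_Mapping.keys (G (Suc i) s t)"
      unfolding homogeneous_vec_def \<sigma>_def using monom_degree_eq_0_iff[of 0] by fastforce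
    then show ?thesis by (simp add: F_def in_keys_iff)
  qed
  ultimately show ?thesis
    unfolding minimal_graded_free_resolution_def by blast
qed

lemma graded_betti_linear:
  assumes "linear_module n (\<lambda>_. 0) m (embed_coord0 ` J)" "J \<subseteq> polys n" "j \<noteq> i + m"
  shows "graded_betti n J i j = 0"
proof -
  let ?F = "SOME F. minimal_graded_free_resolution n J F"
  have "minimal_graded_free_resolution n J ?F"
    using minimal_resolution_exists[OF assms(1,2)] by (rule someI_ex)
  from minimal_resolution_linear[OF this assms(1)]
  have "{s. s < rk ?F i \<and> shift ?F i s = j} = {}"
    using assms(3) by auto
  then show ?thesis by (simp add: graded_betti_def Let_def)
qed

section \<open>Monomial ideals\<close>

definition monom_dvd :: "(nat \<Rightarrow>\<^sub>0 nat) \<Rightarrow> (nat \<Rightarrow>\<^sub>0 nat) \<Rightarrow> bool" where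
  "monom_dvd u m \<longleftrightarrow> (\<forall>i. Poly_Mapping.lookup u i \<le> Poly_Mapping.lookup m i)"

lemma monom_dvd_iff_add: "monom_dvd u m \<longleftrightarrow> (\<exists>c. m = u + c)"
proof
  assume "monom_dvd u m"
  then have "m = u + (m - u)"
    by (intro poly_mapping_eqI) (simp add: monom_dvd_def lookup_add lookup_minus)
  then show "\<exists>c. m = u + c" by blast
qed (auto simp: monom_dvd_def lookup_add)

lemma monom_dvd_refl [simp]: "monom_dvd u u" and monom_dvd_trans: "monom_dvd u v \<Longrightarrow> monom_dvd v w \<Longrightarrow> monom_dvd u w"
  by (auto simp: monom_dvd_def intro: order_trans)

lemma monom_dvd_add_mono: "monom_dvd a b \<Longrightarrow> monom_dvd c d \<Longrightarrow> monom_dvd (a + c) (b + d)"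
  by (auto simp: monom_dvd_def lookup_add intro: add_mono)

lemma monom_dvd_addI: "monom_dvd a b \<Longrightarrow> monom_dvd a (b + c)" "monom_dvd a b \<Longrightarrow> monom_dvd a (c + b)"
  by (auto simp: monom_dvd_def lookup_add intro: add_increasing add_increasing2)

definition mono_ideal :: "nat \<Rightarrow> (nat \<Rightarrow>\<^sub>0 nat) set \<Rightarrow> 'k::field mpoly set" where
  "mono_ideal n B = {f \<in> polys n. \<forall>m \<in> Poly_Mapping.keys f. \<exists>u \<in> B. monom_dvd u m}"

abbreviation monomials_in :: "nat \<Rightarrow> (nat \<Rightarrow>\<^sub>0 nat) set" where
  "monomials_in n \<equiv> {m. Poly_Mapping.keys m \<subseteq> {1..n}}"

abbreviation monomial :: "(nat \<Rightarrow>\<^sub>0 nat) \<Rightarrow> 'k::field mpoly" where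
  "monomial u \<equiv> Poly_Mapping.single u 1"

lemma mono_ideal_polys: "mono_ideal n B \<subseteq> polys n"
  by (auto simp: mono_ideal_def)

lemma mono_ideal_add: "f \<in> mono_ideal n B \<Longrightarrow> g \<in> mono_ideal n B \<Longrightarrow> f + g \<in> mono_ideal n B"
  unfolding mono_ideal_def using keys_add[of f g] by blast

lemma monomial_in_mono_ideal: "u \<in> B \<Longrightarrow> B \<subseteq> monomials_in n \<Longrightarrow> monomial u \<in> mono_ideal n B"
  by (auto simp: mono_ideal_def intro!: bexI[of _ u])

lemma mono_ideal_mult: 
  assumes "f \<in> mono_ideal n B" "g \<in> mono_ideal n C" 
  shows "f * g \<in> mono_ideal n {b + c | b c. b \<in> B \<and> c \<in> C}"
proof -
  have "\<exists>u\<in>{b + c | b c. b \<in> B \<and> c \<in> C}. monom_dvd u m" if m: "m \<in> Poly_Mapping.keys (f * g)" for m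
  proof -
    obtain x y where xy: "m = x + y" "x \<in> Poly_Mapping.keys f" "y \<in> Poly_Mapping.keys g"
      using subsetD[OF keys_mult m] by blast
    obtain b c where "b \<in> B" "monom_dvd b x" "c \<in> C" "monom_dvd c y"
      using assms xy unfolding mono_ideal_def by blast
    then show ?thesis using xy(1) monom_dvd_add_mono by blast
  qed
  then show ?thesis using assms by (auto simp: mono_ideal_def)
qed

lemma mono_ideal_mult_left:
  assumes "f \<in> mono_ideal n B" "g \<in> polys n" shows "g * f \<in> mono_ideal n B"
proof -
  have "\<exists>u\<in>B. monom_dvd u m" if m: "m \<in> Poly_Mapping.keys (g * f)" for m
  proof -
    obtain x y where xy: "m = x + y" "x \<in> Poly_Mapping.keys g" "y \<in> Poly_Mapping.keys f"
      using subsetD[OF keys_mult m] by blast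
    then obtain u where "u \<in> B" "monom_dvd u y" using assms(1) unfolding mono_ideal_def by blast
    then show ?thesis using xy(1) monom_dvd_addI by blast
  qed
  then show ?thesis using assms by (auto simp: mono_ideal_def)
qed

lemma ideal_mono_ideal: "ideal (mono_ideal n B) (poly_ring n :: 'k::field mpoly ring)"
proof -
  interpret R: cring "poly_ring n :: 'k mpoly ring" by (rule cring_poly_ring)
  have eq: "x \<oplus>\<^bsub>poly_ring n\<^esub> y = x + y" "x \<otimes>\<^bsub>poly_ring n\<^esub> y = x * y" "\<zero>\<^bsub>poly_ring n\<^esub> = (0 :: 'k mpoly)" 
    for x y :: "'k mpoly"
    by (simp_all add: poly_ring_def)
  have minus: "- f \<in> mono_ideal n B" if "f \<in> mono_ideal n B" for f :: "'k mpoly"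
    using that by (auto simp: mono_ideal_def keys_minus_general)
  have "subgroup (mono_ideal n B) (add_monoid (poly_ring n :: 'k mpoly ring))"
  proof (rule R.add.subgroupI)
    show "mono_ideal n B \<noteq> ({} :: 'k mpoly set)"
      by (auto simp: mono_ideal_def intro!: exI[of _ 0])
    fix a b :: "'k mpoly" assume a: "a \<in> mono_ideal n B"
    have "\<ominus>\<^bsub>poly_ring n\<^esub> a = - a"
      using a mono_ideal_polys[of n B] by (intro R.minus_equality) (auto simp: eq)
    then show "\<ominus>\<^bsub>poly_ring n\<^esub> a \<in> mono_ideal n B" using minus[OF a] by simp
    assume "b \<in> mono_ideal n B"
    then show "a \<oplus>\<^bsub>poly_ring n\<^esub> b \<in> mono_ideal n B" using a by (simp add: eq mono_ideal_add)
  qed (rule mono_ideal_polys)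
  then show ?thesis
    using mono_ideal_mult_left by (intro idealI R.ring_axioms) (auto simp: eq mult.commute)
qed

lemma sum_of_terms: "(\<Sum>m\<in>Poly_Mapping.keys f. Poly_Mapping.single m (Poly_Mapping.lookup f m)) = f"
proof (rule poly_mapping_eqI)
  fix k
  show "Poly_Mapping.lookup (\<Sum>m\<in>Poly_Mapping.keys f. Poly_Mapping.single m (Poly_Mapping.lookup f m)) k 
      = Poly_Mapping.lookup f k"
    by (simp add: lookup_sum lookup_single when_def in_keys_iff)
qed

text \<open>
  A polynomial in \<open>mono_ideal n B\<close> is the sum of its terms, and each term is a multiple of a monomial
  from \<open>B\<close>.
\<close>

lemma mono_ideal_least:
  fixes I :: "'k::field mpoly set"
  assumes "ideal I (poly_ring n)" "monomial ` B \<subseteq> I"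
  shows "mono_ideal n B \<subseteq> I"
proof
  interpret I: ideal I "poly_ring n" by (rule assms)
  have eq: "x \<oplus>\<^bsub>poly_ring n\<^esub> y = x + y" "x \<otimes>\<^bsub>poly_ring n\<^esub> y = x * y" "\<zero>\<^bsub>poly_ring n\<^esub> = (0 :: 'k mpoly)" 
    for x y :: "'k mpoly"
    by (simp_all add: poly_ring_def)
  have add: "x + y \<in> I" if "x \<in> I" "y \<in> I" for x y
    using additive_subgroup.a_closed[OF ideal.axioms(1)[OF assms(1)] that] by (simp add: eq)
  have zero: "0 \<in> I" using additive_subgroup.zero_closed[OF ideal.axioms(1)[OF assms(1)]] by (simp add: eq)
  have sum: "(\<Sum>i\<in>X. g i) \<in> I" if "\<And>i. i \<in> X \<Longrightarrow> g i \<in> I" for X and g :: "(nat \<Rightarrow>\<^sub>0 nat) \<Rightarrow> 'k mpoly"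
    using that by (induction X rule: infinite_finite_induct) (auto intro: add zero)
  fix f :: "'k mpoly" assume f: "f \<in> mono_ideal n B"
  have "Poly_Mapping.single m (Poly_Mapping.lookup f m) \<in> I" if m: "m \<in> Poly_Mapping.keys f" for m
  proof -
    obtain u c where u: "u \<in> B" "m = u + c"
      using f m unfolding mono_ideal_def monom_dvd_iff_add by blast
    have "Poly_Mapping.keys m \<subseteq> {1..n}" using f m by (auto simp: mono_ideal_def polys_iff)
    then have "Poly_Mapping.single c (Poly_Mapping.lookup f m) \<in> polys n"
      unfolding u(2) by (intro polys_single) (simp add: keys_add_nat)
    then have "monomial u * Poly_Mapping.single c (Poly_Mapping.lookup f m) \<in> I"
      using I.I_r_closed[of "monomial u" "Poly_Mapping.single c (Poly_Mapping.lookup f m)"] assms(2) u(1) 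
      by (auto simp: eq)
    then show ?thesis by (simp add: mult_single u(2))
  qed
  then show "f \<in> I" using sum[of "Poly_Mapping.keys f"] sum_of_terms[of f] by metis
qed

lemma genideal_monomials:
  assumes "B \<subseteq> monomials_in n"
  shows "Idl\<^bsub>poly_ring n\<^esub> (monomial ` B) = (mono_ideal n B :: 'k::field mpoly set)"
proof
  interpret R: cring "poly_ring n :: 'k mpoly ring" by (rule cring_poly_ring)
  have sub: "monomial ` B \<subseteq> (polys n :: 'k mpoly set)" using assms by auto
  have "monomial ` B \<subseteq> (mono_ideal n B :: 'k mpoly set)" using monomial_in_mono_ideal[OF _ assms] by blast
  then show "Idl\<^bsub>poly_ring n\<^esub> (monomial ` B) \<subseteq> (mono_ideal n B :: 'k mpoly set)"
    by (rule R.genideal_minimal[OF ideal_mono_ideal])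
  show "(mono_ideal n B :: 'k mpoly set) \<subseteq> Idl\<^bsub>poly_ring n\<^esub> (monomial ` B)"
    by (rule mono_ideal_least[OF R.genideal_ideal[OF sub] R.genideal_self[OF sub]])
qed

lemma mono_ideal_prod:
  assumes "B \<subseteq> monomials_in n" "C \<subseteq> monomials_in n"
  shows "ideal_prod (poly_ring n) (mono_ideal n B) (mono_ideal n C) = 
    (mono_ideal n {b + c | b c. b \<in> B \<and> c \<in> C} :: 'k::field mpoly set)"
proof
  interpret R: cring "poly_ring n :: 'k mpoly ring" by (rule cring_poly_ring)
  let ?P = "ideal_prod (poly_ring n) (mono_ideal n B) (mono_ideal n C) :: 'k mpoly set"
  have eq: "x \<oplus>\<^bsub>poly_ring n\<^esub> y = x + y" "x \<otimes>\<^bsub>poly_ring n\<^esub> y = x * y" for x y :: "'k mpoly"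
    by (simp_all add: poly_ring_def)
  show "?P \<subseteq> mono_ideal n {b + c | b c. b \<in> B \<and> c \<in> C}"
  proof
    fix f assume "f \<in> ?P"
    then show "f \<in> mono_ideal n {b + c | b c. b \<in> B \<and> c \<in> C}"
      by (induction rule: ideal_prod.induct) (auto simp: eq intro: mono_ideal_mult mono_ideal_add)
  qed
  show "mono_ideal n {b + c | b c. b \<in> B \<and> c \<in> C} \<subseteq> ?P"
  proof (rule mono_ideal_least)
    show "ideal ?P (poly_ring n)"
      by (intro R.ideal_prod_is_ideal ideal_mono_ideal)
    show "monomial ` {b + c | b c. b \<in> B \<and> c \<in> C} \<subseteq> ?P"
    proof clarify
      fix b c assume "b \<in> B" "c \<in> C"
      then have "monomial b \<otimes>\<^bsub>poly_ring n\<^esub> monomial c \<in> ?P"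
        using assms by (intro ideal_prod.prod monomial_in_mono_ideal)
      then show "monomial (b + c) \<in> ?P" by (simp add: eq mult_single)
    qed
  qed
qed

primrec sums_of :: "nat \<Rightarrow> (nat \<Rightarrow>\<^sub>0 nat) set \<Rightarrow> (nat \<Rightarrow>\<^sub>0 nat) set" where
  "sums_of 0 B = {0}"
| "sums_of (Suc k) B = {a + b | a b. a \<in> sums_of k B \<and> b \<in> B}"

lemma sums_of_monomials_in: "B \<subseteq> monomials_in n \<Longrightarrow> sums_of k B \<subseteq> monomials_in n"
proof (induction k)
  case (Suc k)
  then have "Poly_Mapping.keys (a + b) \<subseteq> {1..n}" if "a \<in> sums_of k B" "b \<in> B" for a b
    using that unfolding keys_add_nat by blast
  then show ?case by auto
qed simp

lemma finite_sums_of: "finite B \<Longrightarrow> finite (sums_of k B)"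
proof (induction k)
  case (Suc k)
  have "sums_of (Suc k) B = (\<lambda>(a, b). a + b) ` (sums_of k B \<times> B)" by auto
  then show ?case using Suc by simp
qed simp

lemma ideal_power_mono_ideal:
  assumes "B \<subseteq> monomials_in n"
  shows "ideal_power n (mono_ideal n B :: 'k::field mpoly set) k = mono_ideal n (sums_of k B)"
proof (induction k)
  case 0
  have "mono_ideal n {0} = (polys n :: 'k mpoly set)" by (auto simp: mono_ideal_def monom_dvd_def)
  then show ?case by (simp add: ideal_power_def nat_pow_def ideals_set_def)
next
  case (Suc k)
  have "ideal_power n (mono_ideal n B :: 'k mpoly set) (Suc k) = 
      ideal_prod (poly_ring n) (ideal_power n (mono_ideal n B) k) (mono_ideal n B)"
    by (simp add: ideal_power_def nat_pow_def ideals_set_def)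
  then show ?case
    using mono_ideal_prod[OF sums_of_monomials_in[OF assms] assms] Suc by simp
qed

lemma homogeneous_mono_ideal:
  assumes "B \<subseteq> monomials_in n"
  shows "homogeneous_ideal n (mono_ideal n B)"
proof -
  have "\<forall>g \<in> monomial ` B. \<exists>e. homogeneous e g" by (auto simp: homogeneous_def)
  moreover have "monomial ` B \<subseteq> polys n" using assms by auto
  ultimately show ?thesis
    unfolding homogeneous_ideal_def using genideal_monomials[OF assms] by blast
qed

text \<open>
  Multiplication by a monomial shifts the support of a polynomial without cancellation, so the
  colon ideal is determined by the monomials it contains.
\<close>

lemma strong_persistence_mono_ideal:
  fixes B
  assumes B: "B \<subseteq> monomials_in n"
    and colon: "\<And>k w. (\<And>e. e \<in> B \<Longrightarrow> \<exists>c \<in> sums_of (Suc k) B. monom_dvd c (e + w)) \<Longrightarrow> \<exists>c \<in> sums_of k B. monom_dvd c w"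
  shows "strong_persistence n (mono_ideal n B :: 'k::field mpoly set)"
  unfolding strong_persistence_def
proof (intro allI impI)
  fix k :: nat
  let ?I = "\<lambda>k. mono_ideal n (sums_of k B) :: 'k mpoly set"
  have "ideal_colon n (?I (Suc k)) (mono_ideal n B) = ?I k"
  proof (intro equalityI subsetI)
    fix f assume f: "f \<in> ideal_colon n (?I (Suc k)) (mono_ideal n B)"
    have "\<exists>c \<in> sums_of k B. monom_dvd c w" if w: "w \<in> Poly_Mapping.keys f" for w
    proof (rule colon)
      fix e assume e: "e \<in> B"
      then have "f * monomial e \<in> ?I (Suc k)"
        using f monomial_in_mono_ideal[OF e B] unfolding ideal_colon_def by blast
      moreover have "e + w \<in> Poly_Mapping.keys (monomial e * f)"
        using w by (simp add: keys_single_mult)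
      ultimately show "\<exists>c \<in> sums_of (Suc k) B. monom_dvd c (e + w)"
        unfolding mono_ideal_def mult.commute[of f] by blast
    qed
    then show "f \<in> ?I k" using f by (simp add: mono_ideal_def ideal_colon_def)
  next
    fix f assume f: "f \<in> ?I k"
    then show "f \<in> ideal_colon n (?I (Suc k)) (mono_ideal n B)"
      using mono_ideal_mult[OF f] subsetD[OF mono_ideal_polys f] by (simp add: ideal_colon_def)
  qed
  then show "ideal_colon n (ideal_power n (mono_ideal n B) (k + 1)) (mono_ideal n B) 
      = ideal_power n (mono_ideal n B :: 'k mpoly set) k"
    by (simp only: ideal_power_mono_ideal[OF B] Suc_eq_plus1)
qed

lemma mono_ideal_insert:
  assumes "b \<in> monomials_in n"
  shows "(mono_ideal n (insert b B) :: 'k::field mpoly set) = {v + f * monomial b | v f. v \<in> mono_ideal n B \<and> f \<in> polys n}"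
    (is "?L = ?R")
proof (intro equalityI subsetI)
  fix x :: "'k mpoly" assume "x \<in> ?R"
  then obtain v f where x: "x = v + f * monomial b" "v \<in> mono_ideal n B" "f \<in> polys n" by blast
  have "monomial b \<in> mono_ideal n (insert b B)"
    using assms by (auto simp: mono_ideal_def)
  then have "f * monomial b \<in> mono_ideal n (insert b B)" using x(3) by (rule mono_ideal_mult_left)
  moreover have "v \<in> mono_ideal n (insert b B)" using x(2) by (auto simp: mono_ideal_def)
  ultimately show "x \<in> ?L" unfolding x(1) by (intro mono_ideal_add)
next
  fix x :: "'k mpoly" assume x: "x \<in> ?L"
  define v where "v = restrict_keys (\<lambda>m. \<not> monom_dvd b m) x"
  define y where "y = restrict_keys (monom_dvd b) x"
  define f where "f = Poly_Mapping.map_key (\<lambda>k. b + k) y"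
  have lf: "Poly_Mapping.lookup f k = Poly_Mapping.lookup y (b + k)" for k
    by (simp add: f_def map_key.rep_eq inj_on_def)
  have "x = v + y"
    by (rule poly_mapping_eqI) (simp add: v_def y_def lookup_restrict_keys lookup_add)
  moreover have "v \<in> mono_ideal n B"
    using x by (auto simp: mono_ideal_def v_def keys_restrict_keys)
  moreover have "y = monomial b * f"
  proof (rule poly_mapping_eqI)
    fix k
    show "Poly_Mapping.lookup y k = Poly_Mapping.lookup (monomial b * f) k"
    proof (cases "monom_dvd b k")
      case True
      then obtain c where "k = b + c" by (auto simp: monom_dvd_iff_add)
      then show ?thesis by (simp add: lookup_single_mult lf)
    next
      case False
      then have "k \<notin> Poly_Mapping.keys (monomial b * f)"
        by (auto simp: keys_single_mult monom_dvd_iff_add)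
      then show ?thesis using False by (simp add: in_keys_iff y_def lookup_restrict_keys)
    qed
  qed
  moreover have "f \<in> polys n"
  proof -
    have "y \<in> polys n" using x by (auto simp: y_def mono_ideal_def)
    moreover have "b + k \<in> Poly_Mapping.keys y" if "k \<in> Poly_Mapping.keys f" for k
      using that by (simp add: in_keys_iff lf)
    ultimately show ?thesis unfolding polys_iff by (metis Un_subset_iff keys_add_nat)
  qed
  ultimately show "x \<in> ?R" by (auto simp: mult.commute)
qed

text \<open>
  The generators are added in decreasing order.  If a multiple of \<open>u\<close> by a monomial \<open>k\<close> lies in the ideal
  of the larger generators, say \<open>v\<close> divides \<open>u k\<close>, then the variable \<open>x\<^sub>p\<close> of the exchange property
  divides \<open>k\<close>, and \<open>w\<close> shows that \<open>x\<^sub>p u\<close> already lies in that ideal.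
\<close>

lemma linear_quotients_mono_ideal:
  assumes "finite B" "B \<subseteq> monomials_in n" "\<And>u. u \<in> B \<Longrightarrow> monom_degree u = m"
    and "\<And>u v. u \<in> B \<Longrightarrow> v \<in> B \<Longrightarrow> u < v \<Longrightarrow> 
       \<exists>p. Poly_Mapping.lookup u p < Poly_Mapping.lookup v p \<and> 
         (\<exists>w \<in> B. u < w \<and> monom_dvd w (u + Poly_Mapping.single p 1))"
  shows "linear_module n (\<lambda>_. 0) m (embed_coord0 ` (mono_ideal n B :: 'k::field mpoly set))"
  using assms
proof (induction B rule: finite_linorder_min_induct)
  case empty
  have "f = 0" if "f \<in> mono_ideal n {}" for f :: "'k mpoly"
    using that by (auto simp: mono_ideal_def simp flip: keys_eq_empty)
  then have "mono_ideal n {} = {0 :: 'k mpoly}" by (auto simp: mono_ideal_def)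
  then show ?case by (simp add: linear_module_zero embed_coord0_0)
next
  case (insert b A)
  have IH: "linear_module n (\<lambda>_. 0) m (embed_coord0 ` (mono_ideal n A :: 'k mpoly set))"
  proof (rule insert.IH)
    show "A \<subseteq> monomials_in n" using insert.prems(1) by blast
    show "monom_degree u = m" if "u \<in> A" for u using insert.prems(2) that by blast
    fix u v assume uv: "u \<in> A" "v \<in> A" "u < v"
    then obtain p w where pw: "Poly_Mapping.lookup u p < Poly_Mapping.lookup v p" 
        "w \<in> insert b A" "u < w" "monom_dvd w (u + Poly_Mapping.single p 1)"
      using insert.prems(3)[of u v] by blast
    moreover have "w \<noteq> b" using pw(3) uv(1) insert.hyps(2) by (metis less_asym)
    ultimately show "\<exists>p. Poly_Mapping.lookup u p < Poly_Mapping.lookup v p \<and> 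
         (\<exists>w \<in> A. u < w \<and> monom_dvd w (u + Poly_Mapping.single p 1))" by blast
  qed
  define P where "P = {p \<in> {1..n}. \<exists>w\<in>A. monom_dvd w (b + Poly_Mapping.single p 1)}"
  have colon: "f * monomial b \<in> mono_ideal n A \<longleftrightarrow> f \<in> varideal n P" if f: "f \<in> polys n" for f :: "'k mpoly"
  proof -
    have keys: "Poly_Mapping.keys (f * monomial b) = (+) b ` Poly_Mapping.keys f"
      by (simp add: mult.commute[of f] keys_single_mult)
    have "(\<exists>w\<in>A. monom_dvd w (b + k)) \<longleftrightarrow> (\<exists>p\<in>P. p \<in> Poly_Mapping.keys k)" if k: "k \<in> Poly_Mapping.keys f" for k
    proof
      assume "\<exists>v\<in>A. monom_dvd v (b + k)"
      then obtain v where v: "v \<in> A" "monom_dvd v (b + k)" by blast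
      then have "b < v" using insert.hyps(2) by blast
      then obtain p w where pw: "Poly_Mapping.lookup b p < Poly_Mapping.lookup v p" 
        "w \<in> insert b A" "b < w" "monom_dvd w (b + Poly_Mapping.single p 1)"
        using insert.prems(3)[of b v] v(1) by blast
      have "p \<in> Poly_Mapping.keys v" using pw(1) by (auto simp: in_keys_iff)
      then have "p \<in> {1..n}" using insert.prems(1) v(1) by blast
      then have "p \<in> P" using pw by (auto simp: P_def)
      moreover have "Poly_Mapping.lookup v p \<le> Poly_Mapping.lookup b p + Poly_Mapping.lookup k p"
        using v(2) by (simp add: monom_dvd_def lookup_add)
      then have "p \<in> Poly_Mapping.keys k" using pw(1) by (auto simp: in_keys_iff)
      ultimately show "\<exists>p\<in>P. p \<in> Poly_Mapping.keys k" by blast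
    next
      assume "\<exists>p\<in>P. p \<in> Poly_Mapping.keys k"
      then obtain p w where "p \<in> Poly_Mapping.keys k" "w \<in> A" "monom_dvd w (b + Poly_Mapping.single p 1)"
        by (auto simp: P_def)
      moreover from this have "monom_dvd (Poly_Mapping.single p 1) k"
        by (auto simp: monom_dvd_def lookup_single when_def in_keys_iff)
      ultimately show "\<exists>w\<in>A. monom_dvd w (b + k)"
        using monom_dvd_add_mono[of b b "Poly_Mapping.single p 1" k] monom_dvd_trans by (meson monom_dvd_refl)
    qed
    moreover have "f * monomial b \<in> polys n" using f insert.prems(1) by (auto intro!: polys_mult)
    ultimately show ?thesis using f by (simp add: mono_ideal_def varideal_def keys)
  qed
  have emb_add: "(\<lambda>t. embed_coord0 v t + f * embed_coord0 g t) = embed_coord0 (v + f * g)" for v f g :: "'k mpoly"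
    by (auto simp: embed_coord0_def)
  have emb_mult: "(\<lambda>t. f * embed_coord0 g t) = embed_coord0 (f * g)" for f g :: "'k mpoly"
    by (auto simp: embed_coord0_def)
  have "linear_module n (\<lambda>_. 0) m {\<lambda>t. v t + f * embed_coord0 (monomial b) t | v f. 
      v \<in> embed_coord0 ` (mono_ideal n A :: 'k mpoly set) \<and> f \<in> polys n}"
  proof (rule linear_module_extend[OF IH])
    show "homogeneous_vec (\<lambda>_. 0) m (embed_coord0 (monomial b))"
      using insert.prems(2) by (simp add: homogeneous_vec_def embed_coord0_def)
    show "P \<subseteq> {1..n}" by (auto simp: P_def)
    fix f :: "'k mpoly" assume "f \<in> polys n"
    then show "((\<lambda>t. f * embed_coord0 (monomial b) t) \<in> embed_coord0 ` mono_ideal n A) \<longleftrightarrow> f \<in> varideal n P"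
      using colon by (auto simp: emb_mult embed_coord0_eq_iff image_iff)
  qed
  moreover have "{\<lambda>t. v t + f * embed_coord0 (monomial b) t | v f. 
      v \<in> embed_coord0 ` (mono_ideal n A :: 'k mpoly set) \<and> f \<in> polys n} = 
      embed_coord0 ` (mono_ideal n (insert b A) :: 'k mpoly set)"
  proof -
    have "b \<in> monomials_in n" using insert.prems(1) by blast
    note ins = mono_ideal_insert[OF this, of A]
    show ?thesis unfolding ins
    proof (intro equalityI subsetI)
      fix x assume "x \<in> {\<lambda>t. v t + f * embed_coord0 (monomial b) t | v f. 
        v \<in> embed_coord0 ` (mono_ideal n A :: 'k mpoly set) \<and> f \<in> polys n}"
      then obtain v f where "v \<in> mono_ideal n A" "f \<in> polys n" "x = embed_coord0 (v + f * monomial b)"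
        by (auto simp: emb_add)
      then show "x \<in> embed_coord0 ` {v + f * monomial b |v f. v \<in> mono_ideal n A \<and> f \<in> polys n}" by blast
    next
      fix x assume "x \<in> embed_coord0 ` {v + f * monomial b |v f. v \<in> (mono_ideal n A :: 'k mpoly set) \<and> f \<in> polys n}"
      then obtain v f where "v \<in> mono_ideal n A" "f \<in> polys n" "x = embed_coord0 (v + f * monomial b)" by blast
      then show "x \<in> {\<lambda>t. v t + f * embed_coord0 (monomial b) t | v f. 
        v \<in> embed_coord0 ` (mono_ideal n A :: 'k mpoly set) \<and> f \<in> polys n}"
        unfolding emb_add[symmetric] by blast
    qed
  qed
  ultimately show ?case by simp
qed

lemma has_linear_resolution_mono_ideal:
  assumes "finite B" "B \<subseteq> monomials_in n" "\<And>u. u \<in> B \<Longrightarrow> monom_degree u = m"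
    and "\<And>u v. u \<in> B \<Longrightarrow> v \<in> B \<Longrightarrow> u < v \<Longrightarrow> 
       \<exists>p. Poly_Mapping.lookup u p < Poly_Mapping.lookup v p \<and> 
         (\<exists>w \<in> B. u < w \<and> monom_dvd w (u + Poly_Mapping.single p 1))"
  shows "has_linear_resolution n (mono_ideal n B :: 'k::field mpoly set)"
  unfolding has_linear_resolution_def linear_resolution_of_degree_def
  using graded_betti_linear[OF linear_quotients_mono_ideal[OF assms] mono_ideal_polys]
    homogeneous_mono_ideal[OF assms(2)] by blast

section \<open>Chains in an ordered family of vertex sets\<close>

definition set_monomial :: "nat set \<Rightarrow> nat \<Rightarrow>\<^sub>0 nat" where
  "set_monomial e = (\<Sum>i\<in>e. Poly_Mapping.single i 1)"

lemma lookup_set_monomial: "finite e \<Longrightarrow> Poly_Mapping.lookup (set_monomial e) v = (if v \<in> e then 1 else 0)"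
  by (simp add: set_monomial_def lookup_sum lookup_single when_def)

lemma keys_set_monomial: "finite e \<Longrightarrow> Poly_Mapping.keys (set_monomial e) = e"
  by (auto simp: in_keys_iff lookup_set_monomial split: if_splits)

lemma prod_var: "finite e \<Longrightarrow> (\<Prod>i\<in>e. var i) = (monomial (set_monomial e) :: 'k::field mpoly)"
  by (induction e rule: finite_induct) (simp_all add: var_def set_monomial_def mult_single)

locale spread_family =
  fixes n d :: nat and t :: "nat \<Rightarrow> nat" and V :: "nat \<Rightarrow> nat set"
  assumes d_pos: "1 \<le> d"
    and V_sub: "j \<in> {1..d} \<Longrightarrow> V j \<subseteq> {1..n}"
    and V_ordered: "i \<in> {1..d} \<Longrightarrow> j \<in> {1..d} \<Longrightarrow> i < j \<Longrightarrow> p \<in> V i \<Longrightarrow> q \<in> V j \<Longrightarrow> p < q"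
begin

lemma V_unique: "i \<in> {1..d} \<Longrightarrow> j \<in> {1..d} \<Longrightarrow> v \<in> V i \<Longrightarrow> v \<in> V j \<Longrightarrow> i = j"
  using V_ordered[of i j v v] V_ordered[of j i v v] by (metis less_irrefl linorder_neqE_nat)

lemma V_finite: "j \<in> {1..d} \<Longrightarrow> finite (V j)"
  using V_sub finite_subset by blast

lemma V_bounds: "j \<in> {1..d} \<Longrightarrow> v \<in> V j \<Longrightarrow> 1 \<le> v \<and> v \<le> n"
  using V_sub by fastforce

definition chain :: "(nat \<Rightarrow> nat) \<Rightarrow> bool" where
  "chain \<kappa> \<longleftrightarrow> (\<forall>j \<in> {1..d}. \<kappa> j \<in> V j) \<and> (\<forall>j \<in> {2..d}. \<kappa> (j - 1) + t (j - 1) \<le> \<kappa> j)"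

lemma spread_edges_chain: "spread_edges d t V = {\<kappa> ` {1..d} | \<kappa>. chain \<kappa>}"
  by (simp add: spread_edges_def chain_def)

definition edge_monomials :: "(nat \<Rightarrow>\<^sub>0 nat) set" where
  "edge_monomials = set_monomial ` spread_edges d t V"

definition chain_monomial :: "(nat \<Rightarrow> nat) \<Rightarrow> nat \<Rightarrow>\<^sub>0 nat" where
  "chain_monomial \<kappa> = set_monomial (\<kappa> ` {1..d})"

lemma edge_monomials_chain: "edge_monomials = {chain_monomial \<kappa> | \<kappa>. chain \<kappa>}"
  by (auto simp: edge_monomials_def spread_edges_chain chain_monomial_def)

lemma lookup_chain_monomial: 
  "Poly_Mapping.lookup (chain_monomial \<kappa>) v = (if v \<in> \<kappa> ` {1..d} then 1 else 0)"
  by (simp add: chain_monomial_def lookup_set_monomial)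

lemma keys_chain_monomial: "Poly_Mapping.keys (chain_monomial \<kappa>) = \<kappa> ` {1..d}"
  by (simp add: chain_monomial_def keys_set_monomial)

definition count_below :: "(nat \<Rightarrow>\<^sub>0 nat) \<Rightarrow> nat \<Rightarrow> nat \<Rightarrow> nat" where
  "count_below u j x = (\<Sum>v \<in> {v \<in> V j. v < x}. Poly_Mapping.lookup u v)"

text \<open>
  The exponent vectors of products of \<open>k\<close> edges, described by counting.  All members of \<open>V j\<close> are at
  most \<open>n\<close>, so \<open>count_below u j (Suc n)\<close> is the degree of \<open>u\<close> in the variables from \<open>V j\<close>.
\<close>

definition spread_monomials :: "nat \<Rightarrow> (nat \<Rightarrow>\<^sub>0 nat) set" where
  "spread_monomials k = {u. Poly_Mapping.keys u \<subseteq> (\<Union>j\<in>{1..d}. V j) \<and>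
     (\<forall>j\<in>{1..d}. count_below u j (Suc n) = k) \<and>
     (\<forall>j\<in>{2..d}. \<forall>x. count_below u j (x + t (j - 1)) \<le> count_below u (j - 1) x)}"

lemma below_finite: "j \<in> {1..d} \<Longrightarrow> finite {v \<in> V j. v < x}"
  using V_finite by simp

lemma count_below_add: "count_below (a + b) j x = count_below a j x + count_below b j x"
  by (simp add: count_below_def lookup_add sum.distrib)

lemma count_below_mono: "j \<in> {1..d} \<Longrightarrow> x \<le> y \<Longrightarrow> count_below u j x \<le> count_below u j y"
  unfolding count_below_def by (intro sum_mono2 below_finite) auto

lemma count_below_Suc: 
  assumes "j \<in> {1..d}"
  shows "count_below u j (Suc x) = count_below u j x + (if x \<in> V j then Poly_Mapping.lookup u x else 0)"
proof (cases "x \<in> V j")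
  case True
  then have "{v \<in> V j. v < Suc x} = insert x {v \<in> V j. v < x}" by auto
  then show ?thesis using True below_finite[OF assms, of x] by (simp add: count_below_def)
next
  case False
  then have "{v \<in> V j. v < Suc x} = {v \<in> V j. v < x}" by (auto simp: less_Suc_eq)
  then show ?thesis using False by (simp add: count_below_def)
qed

lemma count_below_0: "count_below u j 0 = 0"
  by (simp add: count_below_def)

lemma count_below_single:
  assumes "j \<in> {1..d}" "p \<in> V j" "i \<in> {1..d}"
  shows "count_below (Poly_Mapping.single p 1) i x = (if i = j \<and> p < x then 1 else 0)"
proof -
  have "count_below (Poly_Mapping.single p 1) i x = (\<Sum>v \<in> {v \<in> V i. v < x}. if v = p then 1 else 0)"
    unfolding count_below_def by (intro sum.cong) (auto simp: lookup_single when_def)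
  moreover have "p \<in> V i \<longleftrightarrow> i = j"
    using V_unique[OF assms(3,1) _ assms(2)] assms(2) by blast
  ultimately show ?thesis
    using below_finite[OF assms(3), of x] by simp
qed

lemma count_below_chain:
  assumes "chain \<kappa>" "j \<in> {1..d}"
  shows "count_below (chain_monomial \<kappa>) j x = (if \<kappa> j < x then 1 else 0)"
proof -
  have "v \<in> \<kappa> ` {1..d} \<longleftrightarrow> v = \<kappa> j" if "v \<in> V j" for v
    using assms that V_unique[OF _ assms(2)] unfolding chain_def by blast
  then have "count_below (chain_monomial \<kappa>) j x = (\<Sum>v \<in> {v \<in> V j. v < x}. if v = \<kappa> j then 1 else 0)"
    unfolding count_below_def by (intro sum.cong) (auto simp: lookup_chain_monomial)
  moreover have "\<kappa> j \<in> V j" using assms by (simp add: chain_def)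
  ultimately show ?thesis
    using below_finite[OF assms(2), of x] by simp
qed

lemma chain_mem: "chain \<kappa> \<Longrightarrow> \<kappa> ` {1..d} \<subseteq> (\<Union>j\<in>{1..d}. V j)"
  by (auto simp: chain_def)

lemma chain_bound: "chain \<kappa> \<Longrightarrow> j \<in> {1..d} \<Longrightarrow> \<kappa> j < Suc n"
  using V_bounds by (force simp: chain_def)

lemma spread_monomials_add_edge:
  assumes "a \<in> spread_monomials k" "chain \<kappa>"
  shows "a + chain_monomial \<kappa> \<in> spread_monomials (Suc k)"
proof -
  let ?e = "chain_monomial \<kappa>"
  have "Poly_Mapping.keys (a + ?e) \<subseteq> (\<Union>j\<in>{1..d}. V j)"
    using assms chain_mem[OF assms(2)] by (auto simp: keys_add_nat keys_chain_monomial spread_monomials_def)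
  moreover have "count_below (a + ?e) j (Suc n) = Suc k" if "j \<in> {1..d}" for j
    using assms(1) that chain_bound[OF assms(2) that] 
    by (simp add: count_below_add count_below_chain[OF assms(2) that] spread_monomials_def)
  moreover have "count_below (a + ?e) j (x + t (j - 1)) \<le> count_below (a + ?e) (j - 1) x" if j: "j \<in> {2..d}" for j x
  proof -
    have jj: "j \<in> {1..d}" "j - 1 \<in> {1..d}" using j by auto
    have "count_below a j (x + t (j - 1)) \<le> count_below a (j - 1) x"
      using assms(1) j by (simp add: spread_monomials_def)
    moreover have "\<kappa> (j - 1) + t (j - 1) \<le> \<kappa> j" using assms(2) j by (simp add: chain_def)
    ultimately show ?thesis
      unfolding count_below_add count_below_chain[OF assms(2) jj(1)] count_below_chain[OF assms(2) jj(2)] by auto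
  qed
  ultimately show ?thesis by (simp add: spread_monomials_def)
qed

text \<open>
  The smallest elements of the support of \<open>u\<close> in the sets \<open>V j\<close> form a chain: below \<open>x + t (j - 1)\<close>,
  with \<open>x\<close> the smallest element of the support in \<open>V (j - 1)\<close>, there is nothing of \<open>u\<close> in \<open>V j\<close>.  Removing them lowers
  each count by one beyond the smallest element, and where only the smaller of two related counts
  stays unchanged it is 0.
\<close>

lemma spread_monomials_peel:
  assumes u: "u \<in> spread_monomials (Suc k)"
  obtains \<kappa> a where "chain \<kappa>" "a \<in> spread_monomials k" "u = a + chain_monomial \<kappa>"
proof -
  define \<kappa> where "\<kappa> j = (LEAST v. v \<in> V j \<and> v \<in> Poly_Mapping.keys u)" for j
  have tot: "count_below u j (Suc n) = Suc k" if "j \<in> {1..d}" for j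
    using u that by (simp add: spread_monomials_def)
  have spread: "count_below u j (x + t (j - 1)) \<le> count_below u (j - 1) x" if "j \<in> {2..d}" for j x
    using u that by (simp add: spread_monomials_def)
  have \<kappa>: "\<kappa> j \<in> V j" "\<kappa> j \<in> Poly_Mapping.keys u" if j: "j \<in> {1..d}" for j
  proof -
    have "\<exists>v \<in> {v \<in> V j. v < Suc n}. Poly_Mapping.lookup u v \<noteq> 0"
    proof (rule ccontr)
      assume "\<not> ?thesis"
      then have "count_below u j (Suc n) = 0" unfolding count_below_def by (intro sum.neutral) blast
      then show False using tot[OF j] by simp
    qed
    then have "\<exists>v. v \<in> V j \<and> v \<in> Poly_Mapping.keys u" by (auto simp: in_keys_iff)
    then have "\<kappa> j \<in> V j \<and> \<kappa> j \<in> Poly_Mapping.keys u" unfolding \<kappa>_def by (rule LeastI_ex)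
    then show "\<kappa> j \<in> V j" "\<kappa> j \<in> Poly_Mapping.keys u" by auto
  qed
  have zero_iff: "count_below u j x = 0 \<longleftrightarrow> x \<le> \<kappa> j" if j: "j \<in> {1..d}" for j x
  proof
    assume "count_below u j x = 0"
    then have "\<not> \<kappa> j < x"
      using \<kappa>[OF j] below_finite[OF j, of x] by (auto simp: count_below_def in_keys_iff)
    then show "x \<le> \<kappa> j" by simp
  next
    assume x: "x \<le> \<kappa> j"
    have "Poly_Mapping.lookup u v = 0" if "v \<in> V j" "v < x" for v
    proof (rule ccontr)
      assume "Poly_Mapping.lookup u v \<noteq> 0"
      then have "\<kappa> j \<le> v" unfolding \<kappa>_def using that by (intro Least_le) (simp add: in_keys_iff)
      then show False using x that by simp
    qed
    then show "count_below u j x = 0" by (simp add: count_below_def)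
  qed
  have chain: "chain \<kappa>"
    unfolding chain_def
  proof (intro conjI ballI)
    fix j assume j: "j \<in> {2..d}"
    then have jj: "j \<in> {1..d}" "j - 1 \<in> {1..d}" by auto
    have "count_below u (j - 1) (\<kappa> (j - 1)) = 0" using zero_iff[OF jj(2)] by simp
    then have "count_below u j (\<kappa> (j - 1) + t (j - 1)) = 0" using spread[OF j] by (metis le_zero_eq)
    then show "\<kappa> (j - 1) + t (j - 1) \<le> \<kappa> j" using zero_iff[OF jj(1)] by simp
  qed (use \<kappa> in auto)
  define e where "e = chain_monomial \<kappa>"
  define a where "a = u - e"
  have ua: "u = a + e"
  proof (rule poly_mapping_eqI)
    fix v show "Poly_Mapping.lookup u v = Poly_Mapping.lookup (a + e) v"
      using \<kappa>(2) by (auto simp: a_def e_def lookup_add lookup_minus lookup_chain_monomial in_keys_iff)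
  qed
  have cnt: "count_below u j x = count_below a j x + (if \<kappa> j < x then 1 else 0)" if "j \<in> {1..d}" for j x
    unfolding ua count_below_add unfolding e_def count_below_chain[OF chain that] ..
  have "a \<in> spread_monomials k"
    unfolding spread_monomials_def
  proof (intro CollectI conjI ballI allI)
    show "Poly_Mapping.keys a \<subseteq> (\<Union>j\<in>{1..d}. V j)"
      using u ua by (simp add: spread_monomials_def keys_add_nat)
    show "count_below a j (Suc n) = k" if j: "j \<in> {1..d}" for j
      using cnt[OF j, of "Suc n"] tot[OF j] chain_bound[OF chain j] by simp
    fix j x assume j: "j \<in> {2..d}"
    then have jj: "j \<in> {1..d}" "j - 1 \<in> {1..d}" by auto
    show "count_below a j (x + t (j - 1)) \<le> count_below a (j - 1) x"
      using spread[OF j, of x] cnt[OF jj(1), of "x + t (j - 1)"] cnt[OF jj(2), of x] 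
        zero_iff[OF jj(1), of "x + t (j - 1)"] zero_iff[OF jj(2), of x]
      by (auto split: if_splits)
  qed
  then show ?thesis using that chain ua by (simp add: e_def)
qed

lemma sums_of_edge_monomials: "sums_of k edge_monomials = spread_monomials k"
proof (induction k)
  case 0
  have "u = 0" if u: "u \<in> spread_monomials 0" for u
  proof -
    have zero: "Poly_Mapping.lookup u v = 0" if v: "v \<in> V j" "j \<in> {1..d}" for v j
    proof -
      have "count_below u j (Suc n) = 0" using u v(2) by (simp add: spread_monomials_def)
      then show ?thesis
        using below_finite[OF v(2), of "Suc n"] v V_bounds[OF v(2,1)] by (auto simp: count_below_def)
    qed
    have "v \<notin> Poly_Mapping.keys u" for v
    proof
      assume v: "v \<in> Poly_Mapping.keys u"
      then obtain j where "j \<in> {1..d}" "v \<in> V j"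
        using u unfolding spread_monomials_def by blast
      then show False using zero v by (simp add: in_keys_iff)
    qed
    then have "Poly_Mapping.keys u = {}" by blast
    then show "u = 0" by simp
  qed
  moreover have "0 \<in> spread_monomials 0" by (simp add: spread_monomials_def count_below_def)
  ultimately show ?case by auto
next
  case (Suc k)
  show ?case
  proof (intro equalityI subsetI)
    fix u assume "u \<in> sums_of (Suc k) edge_monomials"
    then show "u \<in> spread_monomials (Suc k)"
      using Suc spread_monomials_add_edge by (auto simp: edge_monomials_chain)
  next
    fix u assume "u \<in> spread_monomials (Suc k)"
    then obtain \<kappa> a where "chain \<kappa>" "a \<in> spread_monomials k" "u = a + chain_monomial \<kappa>"
      by (rule spread_monomials_peel)
    then show "u \<in> sums_of (Suc k) edge_monomials" using Suc by (auto simp: edge_monomials_chain)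
  qed
qed

lemma spread_monomials_in: "spread_monomials k \<subseteq> monomials_in n"
  unfolding spread_monomials_def using V_sub by blast

lemma edge_monomials_in: "edge_monomials \<subseteq> monomials_in n"
proof -
  have "Poly_Mapping.keys (chain_monomial \<kappa>) \<subseteq> {1..n}" if "chain \<kappa>" for \<kappa>
    using chain_mem[OF that] V_sub unfolding keys_chain_monomial by blast
  then show ?thesis unfolding edge_monomials_chain by blast
qed

lemma finite_edge_monomials: "finite edge_monomials"
proof -
  have "spread_edges d t V \<subseteq> Pow {1..n}"
    using V_sub chain_mem unfolding spread_edges_chain by blast
  then show ?thesis unfolding edge_monomials_def by (meson finite_Pow_iff finite_atLeastAtMost finite_imageI finite_subset)
qed

lemma spread_monomials_degree:
  assumes "u \<in> spread_monomials k" shows "monom_degree u = d * k"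
proof -
  have "monom_degree u = (\<Sum>v\<in>(\<Union>j\<in>{1..d}. V j). Poly_Mapping.lookup u v)"
    using assms V_finite by (intro monom_degree_superset) (auto simp: spread_monomials_def)
  also have "\<dots> = (\<Sum>j\<in>{1..d}. \<Sum>v\<in>V j. Poly_Mapping.lookup u v)"
    using V_finite V_unique by (intro sum.UNION_disjoint) blast+
  also have "\<dots> = (\<Sum>j\<in>{1..d}. k)"
  proof (rule sum.cong)
    fix j assume j: "j \<in> {1..d}"
    then have eq: "{v \<in> V j. v < Suc n} = V j" using V_bounds by force
    have "count_below u j (Suc n) = k" using assms j by (simp add: spread_monomials_def)
    then show "(\<Sum>v\<in>V j. Poly_Mapping.lookup u v) = k"
      by (simp add: count_below_def eq)
  qed simp
  finally show ?thesis by simp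
qed

subsection \<open>The exchange property\<close>

text \<open>
  Let \<open>p \<in> V j\<close> be the first index where \<open>u\<close> and \<open>v\<close> differ, and \<open>q\<close> the next element of \<open>V j\<close> in the
  support of \<open>u\<close>; it exists since \<open>u\<close> and \<open>v\<close> have equal degree in \<open>V j\<close>.  Replacing \<open>q\<close> by \<open>p\<close> raises
  the count in \<open>V j\<close> by one between \<open>p\<close> and \<open>q\<close>.  There the count of \<open>u\<close> has not changed since \<open>p\<close>, where
  it is smaller than that of \<open>v\<close>, and \<open>u\<close> and \<open>v\<close> agree on \<open>V (j - 1)\<close>, all of which lies before \<open>p\<close>;
  so the bound for \<open>v\<close> yields the bound for the new monomial.
\<close>

lemma spread_monomials_exchange:
  assumes u: "u \<in> spread_monomials k" and v: "v \<in> spread_monomials k" and less: "u < v"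
  shows "\<exists>p. Poly_Mapping.lookup u p < Poly_Mapping.lookup v p \<and> 
         (\<exists>w \<in> spread_monomials k. u < w \<and> monom_dvd w (u + Poly_Mapping.single p 1))"
proof -
  obtain p where p: "Poly_Mapping.lookup u p < Poly_Mapping.lookup v p"
    "\<And>i. i < p \<Longrightarrow> Poly_Mapping.lookup u i = Poly_Mapping.lookup v i"
    using less unfolding less_poly_mapping.rep_eq less_fun_def by blast
  have "p \<in> Poly_Mapping.keys v" using p(1) by (auto simp: in_keys_iff)
  then obtain j where j: "j \<in> {1..d}" "p \<in> V j" using v by (auto simp: spread_monomials_def)
  have pn: "p \<le> n" using V_bounds[OF j] by simp
  have same: "count_below u i x = count_below v i x" if "x \<le> p" for i x
    unfolding count_below_def using p(2) that by (intro sum.cong) auto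
  have lt: "count_below u j (Suc p) < count_below v j (Suc p)"
    using p(1) j by (simp add: count_below_Suc same)
  have "\<exists>q. q \<in> V j \<and> p < q \<and> Poly_Mapping.lookup u q \<noteq> 0"
  proof (rule ccontr)
    assume no: "\<not> ?thesis"
    have no': "Poly_Mapping.lookup u i = 0" if "i \<in> V j" "\<not> i < Suc p" for i
      using no that by (metis not_less_eq)
    have "count_below u j (Suc n) = count_below u j (Suc p)"
      unfolding count_below_def
      by (intro sum.mono_neutral_right below_finite[OF j(1)]) (use pn no' in auto)
    moreover have "count_below v j (Suc p) \<le> count_below v j (Suc n)"
      using j(1) pn by (intro count_below_mono) auto
    moreover have "count_below u j (Suc n) = count_below v j (Suc n)"
      using u v j(1) by (simp add: spread_monomials_def)
    ultimately show False using lt by simp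
  qed
  then obtain q where q: "q \<in> V j" "p < q" "Poly_Mapping.lookup u q \<noteq> 0"
    and q_least: "\<And>i. i \<in> V j \<Longrightarrow> p < i \<Longrightarrow> i < q \<Longrightarrow> Poly_Mapping.lookup u i = 0"
    using exists_least_iff[of "\<lambda>q. q \<in> V j \<and> p < q \<and> Poly_Mapping.lookup u q \<noteq> 0"] by blast
  define w where "w = u + Poly_Mapping.single p 1 - Poly_Mapping.single q 1"
  have lw: "Poly_Mapping.lookup w i = Poly_Mapping.lookup u i + (if i = p then 1 else 0) - (if i = q then 1 else 0)" for i
    by (auto simp: w_def lookup_add lookup_minus lookup_single when_def)
  have wq: "w + Poly_Mapping.single q 1 = u + Poly_Mapping.single p 1"
    by (rule poly_mapping_eqI) (use q in \<open>auto simp: lw lookup_add lookup_single when_def\<close>)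
  have cnt: "count_below w i x + (if i = j \<and> q < x then 1 else 0) = count_below u i x + (if i = j \<and> p < x then 1 else 0)"
    if "i \<in> {1..d}" for i x
  proof -
    have "count_below (w + Poly_Mapping.single q 1) i x = count_below (u + Poly_Mapping.single p 1) i x"
      unfolding wq ..
    then show ?thesis
      unfolding count_below_add count_below_single[OF j that] count_below_single[OF j(1) q(1) that] .
  qed
  have "u < w"
    unfolding less_poly_mapping.rep_eq less_fun_def
    using q(2) by (intro exI[of _ p]) (auto simp: lw)
  moreover have "monom_dvd w (u + Poly_Mapping.single p 1)"
    unfolding wq[symmetric] by (simp add: monom_dvd_addI)
  moreover have "w \<in> spread_monomials k"
    unfolding spread_monomials_def
  proof (intro CollectI conjI ballI allI)
    have "Poly_Mapping.keys w \<subseteq> insert p (Poly_Mapping.keys u)"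
      by (auto simp: in_keys_iff lw split: if_splits)
    then show "Poly_Mapping.keys w \<subseteq> (\<Union>j\<in>{1..d}. V j)"
      using u j unfolding spread_monomials_def by blast
    show "count_below w i (Suc n) = k" if i: "i \<in> {1..d}" for i
      using cnt[OF i, of "Suc n"] u i pn V_bounds[OF j(1) q(1)] by (auto simp: spread_monomials_def)
    fix i x assume i: "i \<in> {2..d}"
    then have ii: "i \<in> {1..d}" "i - 1 \<in> {1..d}" "i \<noteq> i - 1" by auto
    have su: "count_below u i (x + t (i - 1)) \<le> count_below u (i - 1) x" using u i by (simp add: spread_monomials_def)
    have sv: "count_below v i (x + t (i - 1)) \<le> count_below v (i - 1) x" using v i by (simp add: spread_monomials_def)
    have up: "count_below u (i - 1) x \<le> count_below w (i - 1) x"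
      using cnt[OF ii(2), of x] q(2) by (auto split: if_splits)
    show "count_below w i (x + t (i - 1)) \<le> count_below w (i - 1) x"
    proof (cases "i = j \<and> p < x + t (i - 1) \<and> x + t (i - 1) \<le> q")
      case True
      let ?y = "x + t (i - 1)"
      have gap: "Poly_Mapping.lookup u a = 0" if "a \<in> V j" "\<not> a < Suc p" "a < ?y" for a
        using q_least[of a] True that by linarith
      have "count_below u j ?y = count_below u j (Suc p)"
        unfolding count_below_def
        by (intro sum.mono_neutral_right below_finite[OF j(1)]) (use gap True in auto)
      moreover have "count_below v j (Suc p) \<le> count_below v j ?y"
        using j(1) True by (intro count_below_mono) auto
      moreover have "count_below v (i - 1) x = count_below u (i - 1) x"
        unfolding count_below_def
      proof (rule sum.cong)
        fix a assume "a \<in> {v \<in> V (i - 1). v < x}"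
        then have "a < p" using V_ordered[OF ii(2) j(1) _ _ j(2)] True i by auto
        then show "Poly_Mapping.lookup v a = Poly_Mapping.lookup u a" using p(2) by simp
      qed simp
      ultimately have "count_below u i ?y + 1 \<le> count_below u (i - 1) x"
        using lt sv True by simp
      moreover have "count_below w i ?y = count_below u i ?y + 1"
        using cnt[OF ii(1), of ?y] True by (auto split: if_splits)
      ultimately show ?thesis using up by simp
    next
      case False
      then have "count_below w i (x + t (i - 1)) = count_below u i (x + t (i - 1))"
        using cnt[OF ii(1), of "x + t (i - 1)"] q(2) by (auto split: if_splits)
      then show ?thesis using su up by simp
    qed
  qed
  ultimately show ?thesis using p(1) by blast
qed

subsection \<open>Vertex covers and strong persistence\<close>

definition cover :: "nat set \<Rightarrow> bool" where
  "cover C \<longleftrightarrow> (\<forall>\<kappa>. chain \<kappa> \<longrightarrow> (\<exists>j\<in>{1..d}. \<kappa> j \<in> C))"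

text \<open>
  Every family of thresholds \<open>y 0 = 0, y 1, \<dots>, y d = n + 1\<close> gives a cover: the vertices of \<open>V j\<close>
  from \<open>y (j - 1) + t (j - 1)\<close> (with 0 for \<open>t 0\<close>) to below \<open>y j\<close>, for a chain avoiding it would stay at or above all
  thresholds.  Let \<open>N j x\<close> be the least weight in \<open>w\<close> of such a cut of the first \<open>j\<close> sets with last
  threshold \<open>x\<close>; a start at \<open>y 0 > 0\<close> costs \<open>k\<close>, which truncates the flow.  As a function of \<open>x\<close> it
  grows only at the vertices of \<open>V j\<close>, by at most the exponent of \<open>w\<close>, so its increments are the
  exponents of a divisor \<open>u\<close> of \<open>w\<close> with counts \<open>N j\<close>.  The recursion for \<open>N\<close> contains the defining
  inequalities of \<open>spread_monomials\<close>, and the degrees of \<open>u\<close> are \<open>k\<close> as all cuts have weight at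
  least \<open>k\<close>.
\<close>

lemma max_flow_min_cut:
  assumes cut: "\<And>C. C \<subseteq> {1..n} \<Longrightarrow> cover C \<Longrightarrow> k \<le> (\<Sum>v\<in>C. Poly_Mapping.lookup w v)"
  shows "\<exists>u \<in> spread_monomials k. monom_dvd u w"
proof -
  \<comment> \<open>\<open>t 0\<close> is arbitrary; there is no spread condition before the first set\<close>
  define tt where "tt j = (if j = 0 then 0 else t j)" for j
  define W where "W j a b = (\<Sum>v \<in> {v \<in> V j. a \<le> v \<and> v < b}. Poly_Mapping.lookup w v)" for j a b
  define N where "N = rec_nat (\<lambda>x. if x = 0 then 0 else k) (\<lambda>j N x. INF y. N y + W (Suc j) (y + tt j) x)"
  have N0: "N 0 x = (if x = 0 then 0 else k)" for x by (simp add: N_def)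
  have NS: "N (Suc j) x = (INF y. N j y + W (Suc j) (y + tt j) x)" for j x by (simp add: N_def)
  have N_le: "N (Suc j) x \<le> N j y + W (Suc j) (y + tt j) x" for j x y
    unfolding NS by (rule cINF_lower) auto
  have N_att: "\<exists>y. N (Suc j) x = N j y + W (Suc j) (y + tt j) x" for j x
    unfolding NS using Inf_nat_def1[of "range (\<lambda>y. N j y + W (Suc j) (y + tt j) x)"] by auto
  have W_empty: "b \<le> a \<Longrightarrow> W j a b = 0" for j a b
  proof -
    assume "b \<le> a"
    then have "{v \<in> V j. a \<le> v \<and> v < b} = {}" by auto
    then show "W j a b = 0" unfolding W_def by (simp only: sum.empty)
  qed
  have W_Suc: "W j a x \<le> W j a (Suc x) \<and> W j a (Suc x) \<le> W j a x + (if x \<in> V j then Poly_Mapping.lookup w x else 0)"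
    if j: "j \<in> {1..d}" for j a x
  proof
    have fin: "finite {v \<in> V j. a \<le> v \<and> v < y}" for y using V_finite[OF j] by simp
    show "W j a x \<le> W j a (Suc x)" unfolding W_def by (intro sum_mono2 fin) auto
    show "W j a (Suc x) \<le> W j a x + (if x \<in> V j then Poly_Mapping.lookup w x else 0)"
    proof (cases "x \<in> V j")
      case True
      have "W j a (Suc x) \<le> (\<Sum>v \<in> insert x {v \<in> V j. a \<le> v \<and> v < x}. Poly_Mapping.lookup w v)"
        unfolding W_def using fin by (intro sum_mono2) auto
      then show ?thesis using True fin by (simp add: W_def)
    next
      case False
      then have eq: "{v \<in> V j. a \<le> v \<and> v < Suc x} = {v \<in> V j. a \<le> v \<and> v < x}" by (auto simp: less_Suc_eq)
      show ?thesis unfolding W_def eq by simp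
    qed
  qed
  have N_spread: "N (Suc j) (x + tt j) \<le> N j x" for j x
    using N_le[of j "x + tt j" x] W_empty[of "x + tt j" "x + tt j"] by simp
  have N_anti: "N (Suc j) x \<le> N j x" for j x
    using N_le[of j x x] W_empty[of x "x + tt j"] by simp
  have N_zero: "N j 0 = 0" for j
  proof (induction j)
    case (Suc j)
    then show ?case using N_anti[of j 0] by simp
  qed (simp add: N0)
  have N_step: "N j x \<le> N j (Suc x) \<and> N j (Suc x) \<le> N j x + (if x \<in> V j then Poly_Mapping.lookup w x else 0)"
    if j: "j \<in> {1..d}" for j x
  proof -
    obtain i where i: "j = Suc i" using j by (cases j) auto
    obtain y where y: "N j (Suc x) = N i y + W j (y + tt i) (Suc x)" using N_att unfolding i by blast
    obtain z where z: "N j x = N i z + W j (z + tt i) x" using N_att unfolding i by blast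
    show ?thesis
      using N_le[of i x y] N_le[of i "Suc x" z] W_Suc[OF j, of "y + tt i" x] W_Suc[OF j, of "z + tt i" x] y z
      unfolding i[symmetric] by linarith
  qed
  have unfold: "\<exists>y. y j = x \<and> N j x = N 0 (y 0) + (\<Sum>i\<in>{1..j}. W i (y (i - 1) + tt (i - 1)) (y i))" for j x
  proof (induction j arbitrary: x)
    case 0
    show ?case by (rule exI[of _ "\<lambda>_. x"]) simp
  next
    case (Suc j)
    obtain z where z: "N (Suc j) x = N j z + W (Suc j) (z + tt j) x" using N_att by blast
    obtain y where y: "y j = z" "N j z = N 0 (y 0) + (\<Sum>i\<in>{1..j}. W i (y (i - 1) + tt (i - 1)) (y i))"
      using Suc by blast
    let ?y = "y(Suc j := x)"
    have "(\<Sum>i\<in>{1..j}. W i (?y (i - 1) + tt (i - 1)) (?y i)) = (\<Sum>i\<in>{1..j}. W i (y (i - 1) + tt (i - 1)) (y i))"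
      by (intro sum.cong) auto
    then show ?case using y z by (intro exI[of _ ?y]) simp
  qed
  have "k \<le> N d (Suc n)"
  proof -
    obtain y where y: "y d = Suc n" "N d (Suc n) = N 0 (y 0) + (\<Sum>i\<in>{1..d}. W i (y (i - 1) + tt (i - 1)) (y i))"
      using unfold by blast
    show ?thesis
    proof (cases "y 0 = 0")
      case False
      then show ?thesis using y(2) N0 by simp
    next
      case True
      define S where "S i = {v \<in> V i. y (i - 1) + tt (i - 1) \<le> v \<and> v < y i}" for i
      \<comment> \<open>the cut given by the thresholds \<open>y\<close>\<close>
      define C where "C = (\<Union>i\<in>{1..d}. S i)"
      have "cover C"
        unfolding cover_def
      proof (intro allI impI, rule ccontr)
        fix \<kappa> assume \<kappa>: "chain \<kappa>" and "\<not> (\<exists>j\<in>{1..d}. \<kappa> j \<in> C)"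
        then have no: "\<kappa> j \<notin> S j" if "j \<in> {1..d}" for j using that unfolding C_def by blast
        have "j \<in> {1..d} \<Longrightarrow> y j \<le> \<kappa> j" for j
        proof (induction j)
          case (Suc j)
          have mem: "\<kappa> (Suc j) \<in> V (Suc j)" using \<kappa> Suc.prems by (simp add: chain_def)
          have "y j + tt j \<le> \<kappa> (Suc j)"
          proof (cases "j = 0")
            case True
            then show ?thesis using \<open>y 0 = 0\<close> by (simp add: tt_def)
          next
            case False
            then have "\<kappa> j + t j \<le> \<kappa> (Suc j)" 
              using \<kappa>[unfolded chain_def, THEN conjunct2, rule_format, of "Suc j"] Suc.prems by simp
            moreover have "y j \<le> \<kappa> j" using Suc False by simp
            ultimately show ?thesis using False by (simp add: tt_def)
          qed
          then show ?case using no[OF Suc.prems] mem by (simp add: S_def)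
        qed simp
        then have "Suc n \<le> \<kappa> d" using y(1) d_pos by fastforce
        then show False using chain_bound[OF \<kappa>, of d] d_pos by simp
      qed
      moreover have "C \<subseteq> {1..n}" using V_sub unfolding C_def S_def by blast
      ultimately have "k \<le> (\<Sum>v\<in>C. Poly_Mapping.lookup w v)" using cut by blast
      also have "\<dots> = (\<Sum>i\<in>{1..d}. \<Sum>v\<in>S i. Poly_Mapping.lookup w v)"
        unfolding C_def
      proof (rule sum.UNION_disjoint)
        show "\<forall>i\<in>{1..d}. \<forall>j\<in>{1..d}. i \<noteq> j \<longrightarrow> S i \<inter> S j = {}"
          using V_unique by (auto simp: S_def)
      qed (use V_finite in \<open>auto simp: S_def\<close>)
      also have "\<dots> = (\<Sum>i\<in>{1..d}. W i (y (i - 1) + tt (i - 1)) (y i))" by (simp add: W_def S_def)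
      also have "\<dots> \<le> N d (Suc n)" using y(2) by simp
      finally show ?thesis .
    qed
  qed
  moreover have "N d (Suc n) \<le> N j (Suc n)" if "j \<le> d" for j
    using lift_Suc_antimono_le[of "\<lambda>j. N j (Suc n)", OF N_anti that] .
  moreover have "N j (Suc n) \<le> k" for j
    using lift_Suc_antimono_le[of "\<lambda>j. N j (Suc n)", OF N_anti, of 0 j] N0 by simp
  ultimately have N_top: "N j (Suc n) = k" if "j \<le> d" for j
    using that by (meson le_antisym le_trans)
  define u where "u = (\<Sum>j\<in>{1..d}. \<Sum>v\<in>V j. Poly_Mapping.single v (N j (Suc v) - N j v))"
  have lu: "Poly_Mapping.lookup u v = (\<Sum>j\<in>{1..d}. if v \<in> V j then N j (Suc v) - N j v else 0)" for v
    unfolding u_def lookup_sum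
    by (intro sum.cong refl) (use V_finite in \<open>auto simp: lookup_single when_def\<close>)
  have lu_in: "Poly_Mapping.lookup u v = N j (Suc v) - N j v" if "j \<in> {1..d}" "v \<in> V j" for j v
  proof -
    have iff: "v \<in> V i \<longleftrightarrow> i = j" if i: "i \<in> {1..d}" for i
      using V_unique[OF i \<open>j \<in> {1..d}\<close>] \<open>v \<in> V j\<close> by blast
    have "Poly_Mapping.lookup u v = (\<Sum>i\<in>{1..d}. if i = j then N j (Suc v) - N j v else 0)"
      unfolding lu by (intro sum.cong refl) (simp only: iff split: if_split, simp)
    then show ?thesis using that(1) by simp
  qed
  have cnt: "count_below u j x = N j x" if j: "j \<in> {1..d}" for j x
  proof (induction x)
    case 0
    show ?case by (simp add: count_below_0 N_zero)
  next
    case (Suc x)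
    then show ?case using N_step[OF j, of x] lu_in[OF j, of x] by (auto simp: count_below_Suc[OF j])
  qed
  have out: "Poly_Mapping.lookup u v = 0" if "v \<notin> (\<Union>j\<in>{1..d}. V j)" for v
    unfolding lu using that by (intro sum.neutral) auto
  have "u \<in> spread_monomials k"
    unfolding spread_monomials_def
  proof (intro CollectI conjI ballI allI)
    show "Poly_Mapping.keys u \<subseteq> (\<Union>j\<in>{1..d}. V j)" using out by (meson in_keys_iff subsetI)
    show "count_below u j (Suc n) = k" if "j \<in> {1..d}" for j using cnt[OF that] N_top that by simp
    fix j x assume j: "j \<in> {2..d}"
    then have jj: "j \<in> {1..d}" "j - 1 \<in> {1..d}" "Suc (j - 1) = j" "tt (j - 1) = t (j - 1)" by (auto simp: tt_def)
    show "count_below u j (x + t (j - 1)) \<le> count_below u (j - 1) x"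
      using N_spread[of "j - 1" x] unfolding cnt[OF jj(1)] cnt[OF jj(2)] jj(3,4) .
  qed
  moreover have "monom_dvd u w"
    unfolding monom_dvd_def
  proof
    fix v
    show "Poly_Mapping.lookup u v \<le> Poly_Mapping.lookup w v"
    proof (cases "v \<in> (\<Union>j\<in>{1..d}. V j)")
      case True
      then obtain j where j: "j \<in> {1..d}" "v \<in> V j" by blast
      show ?thesis using N_step[OF j(1), of v] lu_in[OF j] j(2) by auto
    qed (simp add: out)
  qed
  ultimately show ?thesis by blast
qed

lemma cover_weight_sums_of:
  assumes "cover C" "finite C" "c \<in> sums_of k edge_monomials"
  shows "k \<le> (\<Sum>v\<in>C. Poly_Mapping.lookup c v)"
  using assms(3)
proof (induction k arbitrary: c)
  case (Suc k)
  then obtain a \<kappa> where a: "a \<in> sums_of k edge_monomials" "chain \<kappa>" "c = a + chain_monomial \<kappa>"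
    by (auto simp: edge_monomials_chain)
  obtain j where j: "j \<in> {1..d}" "\<kappa> j \<in> C" using assms(1) a(2) by (auto simp: cover_def)
  have "Poly_Mapping.lookup (chain_monomial \<kappa>) (\<kappa> j) \<le> (\<Sum>v\<in>C. Poly_Mapping.lookup (chain_monomial \<kappa>) v)"
    using j assms(2) by (intro member_le_sum) auto
  then have "1 \<le> (\<Sum>v\<in>C. Poly_Mapping.lookup (chain_monomial \<kappa>) v)"
    using j by (simp add: lookup_chain_monomial)
  then show ?case using Suc.IH[OF a(1)] by (simp add: a(3) lookup_add sum.distrib)
qed simp

text \<open>
  It suffices to bound the weight of minimal covers, and each element of a minimal cover \<open>D\<close> lies on
  a chain that meets \<open>D\<close> nowhere else.
\<close>

lemma colon_sums_of:
  assumes edge: "\<exists>\<kappa>. chain \<kappa>"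
    and colon: "\<And>e. e \<in> edge_monomials \<Longrightarrow> \<exists>c \<in> sums_of (Suc k) edge_monomials. monom_dvd c (e + w)"
  shows "\<exists>c \<in> sums_of k edge_monomials. monom_dvd c w"
  unfolding sums_of_edge_monomials
proof (rule max_flow_min_cut)
  fix C assume C: "C \<subseteq> {1..n}" "cover C"
  then have "finite {D. D \<subseteq> C \<and> cover D}" "{D. D \<subseteq> C \<and> cover D} \<noteq> {}"
    using finite_subset[OF C(1)] by auto
  then obtain D where DD: "D \<in> {D. D \<subseteq> C \<and> cover D}" "\<forall>D' \<in> {D. D \<subseteq> C \<and> cover D}. D' \<subseteq> D \<longrightarrow> D = D'"
    by (rule bexE[OF finite_has_minimal])
  have D: "D \<subseteq> C" "cover D" "\<And>D'. D' \<subseteq> C \<Longrightarrow> cover D' \<Longrightarrow> D' \<subseteq> D \<Longrightarrow> D = D'"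
    using DD(1) bspec[OF DD(2)] by simp_all
  have finD: "finite D" "finite C" using C D finite_subset[OF _ finite_atLeastAtMost] by blast+
  obtain c0 where c0: "c0 \<in> D" using edge D(2) by (auto simp: cover_def)
  then have "\<not> cover (D - {c0})" using D(1) D(3)[of "D - {c0}"] by blast
  then obtain \<kappa> where \<kappa>: "chain \<kappa>" "\<And>j. j \<in> {1..d} \<Longrightarrow> \<kappa> j \<notin> D - {c0}" by (auto simp: cover_def)
  let ?e = "chain_monomial \<kappa>"
  have "?e \<in> edge_monomials" using \<kappa>(1) by (auto simp: edge_monomials_chain)
  then obtain c where c: "c \<in> sums_of (Suc k) edge_monomials" "monom_dvd c (?e + w)" using colon by blast
  have "Suc k \<le> (\<Sum>v\<in>D. Poly_Mapping.lookup c v)" by (rule cover_weight_sums_of[OF D(2) finD(1) c(1)])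
  also have "\<dots> \<le> (\<Sum>v\<in>D. Poly_Mapping.lookup (?e + w) v)"
    using c(2) by (intro sum_mono) (simp add: monom_dvd_def)
  also have "\<dots> = (\<Sum>v\<in>D. Poly_Mapping.lookup ?e v) + (\<Sum>v\<in>D. Poly_Mapping.lookup w v)"
    by (simp add: lookup_add sum.distrib)
  also have "(\<Sum>v\<in>D. Poly_Mapping.lookup ?e v) \<le> (\<Sum>v\<in>D. if v = c0 then 1 else 0)"
    using \<kappa>(2) by (intro sum_mono) (auto simp: lookup_chain_monomial)
  also have "\<dots> = 1" using finD c0 by simp
  finally have "k \<le> (\<Sum>v\<in>D. Poly_Mapping.lookup w v)" by simp
  also have "\<dots> \<le> (\<Sum>v\<in>C. Poly_Mapping.lookup w v)" using D(1) finD by (intro sum_mono2) auto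
  finally show "k \<le> (\<Sum>v\<in>C. Poly_Mapping.lookup w v)" .
qed

end

section \<open>Powers of the edge ideal\<close>

theorem corollary3p7:
  fixes n d :: nat and t :: "nat \<Rightarrow> nat" and V :: "nat \<Rightarrow> nat set"
  assumes "n \<ge> 1" and "d \<ge> 1"
    and "\<forall>i \<in> {1..<d}. t i \<ge> 1"
    and "\<forall>i \<in> {1..d}. V i \<noteq> {} \<and> V i \<subseteq> {1..n}"
    and "disjoint_family_on V {1..d}"
    and "\<forall>i \<in> {1..d}. \<forall>j \<in> {1..d}. i < j \<longrightarrow> (\<forall>p \<in> V i. \<forall>q \<in> V j. p < q)"
    and "no_isolated_vertices (complete_spread_hypergraph d t V)"
  defines "I \<equiv> (edge_ideal n (complete_spread_hypergraph d t V) :: 'k::field mpoly set)"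
  shows "strong_persistence n I \<and> (\<forall>k \<ge> 1. has_linear_resolution n (ideal_power n I k))"
proof -
  interpret spread_family n d t V
    using assms by unfold_locales blast+
  have "{(\<Prod>i \<in> e. var i) | e. e \<in> spread_edges d t V} = (monomial ` edge_monomials :: 'k mpoly set)"
    unfolding edge_monomials_def image_image
    by (auto simp: spread_edges_chain image_iff prod_var) (metis finite_atLeastAtMost finite_imageI prod_var)+
  then have I: "I = mono_ideal n edge_monomials"
    unfolding I_def edge_ideal_def complete_spread_hypergraph_def 
    by (simp add: genideal_monomials[OF edge_monomials_in])
  obtain v where "v \<in> V 1" "v \<in> (\<Union>j \<in> {1..d}. V j)" using assms(2,4) by fastforce
  then have edge: "\<exists>\<kappa>. chain \<kappa>"
    using assms(7) by (fastforce simp: no_isolated_vertices_def complete_spread_hypergraph_def spread_edges_chain)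
  have "strong_persistence n I"
    unfolding I by (rule strong_persistence_mono_ideal[OF edge_monomials_in colon_sums_of[OF edge]])
  moreover have "has_linear_resolution n (ideal_power n I k)" for k
    unfolding I ideal_power_mono_ideal[OF edge_monomials_in] 
  proof (rule has_linear_resolution_mono_ideal)
    show "finite (sums_of k edge_monomials)" by (intro finite_sums_of finite_edge_monomials)
  qed (simp_all only: sums_of_edge_monomials spread_monomials_in spread_monomials_degree spread_monomials_exchange)
  ultimately show ?thesis by blast
qed

end
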